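(* Fix $K\in\mathbb N$ and a realization of the random basis functions $\phi_1,\dots,\phi_K$. Assume that $\mathbb Q\big[\alpha(\Pi_n^KE_nP_{n+1}^K)(X_n)=g(X_n)\big]=0$ for all $0\le n\le N-1$. Then the implementable price $U_0^{K,m}$ converges almost surely (with respect to the sampling of the paths) to the idealized price $U_0^K$ as $m\to\infty$.
   Context: Let $d,N\ge 1$ and let $X=(X_0,\dots,X_N)$ be a discrete-time Markov process with values in $\mathbb{R}^d$ on a filtered probability space $(\Omega,\mathcal F,(\mathcal F_n)_{n=0}^N,\mathbb P)$, with $X_0=x_0$ deterministic; let $\mathbb Q\ll\mathbb P$ be a probability measure (the pricing measure), $\pi_n$ the law of $X_n$ under $\mathbb Q$, and $\mathbb E$ expectation under $\mathbb Q$. Let $g:\mathbb{R}^d\to[0,\infty)$ be a measurable payoff with $g(X_n)$ square integrable under $\mathbb Q$ for all $n$, and let $\alpha>0$ be the one-step discount factor. Set $\lVert f\rVert_{\pi_n}^2:=\int|f|^2d\pi_n$ and $(E_nJ)(x):=\mathbb E[J(X_{n+1})\mid X_n=x]$. Random basis functions: $\alpha_k\in\mathbb{R}^d,\beta_k\in\mathbb{R}$ with all entries i.i.d. standard Gaussian; $\phi_k(x):=\sigma(\alpha_k^\top x+\beta_k)$ with $\sigma$ a bounded activation function; $(\Phi_K\theta)(x):=\sum_{k=1}^K\theta_k\phi_k(x)$; $\Pi_n^KJ:=\arg\min_{\Phi_K\theta}\lVert J-\Phi_K\theta\rVert_{\pi_n}$ (the $L^2(\pi_n)$-projection onto $\mathrm{span}(\phi_1,\dots,\phi_K)$).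 Idealized algorithm: $P_N^K:=g$ and, for $n<N$, $P_n^K:=g\,\mathbf 1_{\{g\ge\alpha\Pi_n^KE_nP_{n+1}^K\}}+\alpha E_nP_{n+1}^K\,\mathbf 1_{\{g<\alpha\Pi_n^KE_nP_{n+1}^K\}}$; $\tilde Q_0^K:=\alpha E_0P_1^K$; idealized price $U_0^K:=\max(g(x_0),\tilde Q_0^K(x_0))$. Implementable algorithm: let $(x_1^i,\dots,x_N^i)$, $i=1,\dots,m$, be i.i.d. samples of $(X_1,\dots,X_N)$ under $\mathbb Q$. Set $p_N^i:=g(x_N^i)$ and recursively for $n=N-1,\dots,1$: let $\hat\theta_n\in\mathbb R^K$ be a minimizer of $\theta\mapsto\frac1m\sum_{i=1}^m\big(p_{n+1}^i-(\Phi_K\theta)(x_n^i)\big)^2$ (the fitted values $(\Phi_K\hat\theta_n)(x_n^i)$ do not depend on the choice of minimizer; this is the empirical projection $\hat\Pi_n^K$ of the one-sample conditional expectation), and set $p_n^i:=g(x_n^i)$ if $g(x_n^i)\ge\alpha(\Phi_K\hat\theta_n)(x_n^i)$, and $p_n^i:=\alpha p_{n+1}^i$ otherwise. The implementable price is $U_0^{K,m}:=\max\big(g(x_0),\frac1m\sum_{i=1}^m\alpha p_1^i\big)$.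
   Formalization: The Markov property of X is assumed under the pricing measure Q (not only under P); with X Markov under P alone and Q ≪ P arbitrary, the claimed convergence can fail. *)

theory Defs
  imports "HOL-Analysis.Analysis" "HOL-Probability.Probability"
begin

text \<open>Random basis functions for a fixed realization a k, b k of the Gaussian parameters.\<close>
definition rbf :: "(real \<Rightarrow> real) \<Rightarrow> (nat \<Rightarrow> real^'d) \<Rightarrow> (nat \<Rightarrow> real) \<Rightarrow> nat \<Rightarrow> real^'d \<Rightarrow> real" where
  "rbf \<sigma> a b k x = \<sigma> (a k \<bullet> x + b k)"

definition PhiK :: "(real \<Rightarrow> real) \<Rightarrow> (nat \<Rightarrow> real^'d) \<Rightarrow> (nat \<Rightarrow> real) \<Rightarrow> nat \<Rightarrow> (nat \<Rightarrow> real) \<Rightarrow> real^'d \<Rightarrow> real" where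
  "PhiK \<sigma> a b K \<theta> x = (\<Sum>k<K. \<theta> k * rbf \<sigma> a b k x)"

definition span_rbf :: "(real \<Rightarrow> real) \<Rightarrow> (nat \<Rightarrow> real^'d) \<Rightarrow> (nat \<Rightarrow> real) \<Rightarrow> nat \<Rightarrow> (real^'d \<Rightarrow> real) set" where
  "span_rbf \<sigma> a b K = {PhiK \<sigma> a b K \<theta> | \<theta>. True}"

text \<open>L2(pi)-projection onto span(phi_1..phi_K) (a minimizer; unique pi-a.e.).\<close>
definition L2proj :: "(real^'d) measure \<Rightarrow> (real \<Rightarrow> real) \<Rightarrow> (nat \<Rightarrow> real^'d) \<Rightarrow> (nat \<Rightarrow> real) \<Rightarrow> nat
     \<Rightarrow> (real^'d \<Rightarrow> real) \<Rightarrow> (real^'d \<Rightarrow> real)" where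
  "L2proj \<pi> \<sigma> a b K J = (SOME f. f \<in> span_rbf \<sigma> a b K \<and>
      (\<forall>h\<in>span_rbf \<sigma> a b K. (\<integral>x. (J x - f x)\<^sup>2 \<partial>\<pi>) \<le> (\<integral>x. (J x - h x)\<^sup>2 \<partial>\<pi>)))"

text \<open>One-step conditional expectation (E_n J)(x) = E[J(X_{n+1}) | X_n = x], via the transition kernel.\<close>
definition condE :: "(nat \<Rightarrow> real^'d \<Rightarrow> (real^'d) measure) \<Rightarrow> nat \<Rightarrow> (real^'d \<Rightarrow> real) \<Rightarrow> real^'d \<Rightarrow> real" where
  "condE \<kappa> n J x = (\<integral>y. J y \<partial>(\<kappa> n x))"

text \<open>Law pi_n of X_n under Q, where mu is the law of the path (X_0,...,X_N).\<close>
definition marg :: "(nat \<Rightarrow> real^'d) measure \<Rightarrow> nat \<Rightarrow> (real^'d) measure" where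
  "marg \<mu> n = distr \<mu> borel (\<lambda>\<omega>. \<omega> n)"

text \<open>Idealized algorithm: Pid_aux ... j = P_{N-j}.\<close>
primrec Pid_aux :: "(real^'d \<Rightarrow> real) \<Rightarrow> real \<Rightarrow> (nat \<Rightarrow> real^'d \<Rightarrow> (real^'d) measure) \<Rightarrow> (nat \<Rightarrow> real^'d) measure
    \<Rightarrow> (real \<Rightarrow> real) \<Rightarrow> (nat \<Rightarrow> real^'d) \<Rightarrow> (nat \<Rightarrow> real) \<Rightarrow> nat \<Rightarrow> nat \<Rightarrow> nat \<Rightarrow> (real^'d \<Rightarrow> real)" where
  "Pid_aux g disc \<kappa> \<mu> \<sigma> a b K N 0 = g"
| "Pid_aux g disc \<kappa> \<mu> \<sigma> a b K N (Suc j) =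
    (let n = N - Suc j;
         C = condE \<kappa> n (Pid_aux g disc \<kappa> \<mu> \<sigma> a b K N j);
         PC = L2proj (marg \<mu> n) \<sigma> a b K C
     in (\<lambda>x. if g x \<ge> disc * PC x then g x else disc * C x))"

definition Pid :: "(real^'d \<Rightarrow> real) \<Rightarrow> real \<Rightarrow> (nat \<Rightarrow> real^'d \<Rightarrow> (real^'d) measure) \<Rightarrow> (nat \<Rightarrow> real^'d) measure
    \<Rightarrow> (real \<Rightarrow> real) \<Rightarrow> (nat \<Rightarrow> real^'d) \<Rightarrow> (nat \<Rightarrow> real) \<Rightarrow> nat \<Rightarrow> nat \<Rightarrow> nat \<Rightarrow> (real^'d \<Rightarrow> real)" where
  "Pid g disc \<kappa> \<mu> \<sigma> a b K N n = Pid_aux g disc \<kappa> \<mu> \<sigma> a b K N (N - n)"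

definition Uid :: "(real^'d \<Rightarrow> real) \<Rightarrow> real \<Rightarrow> (nat \<Rightarrow> real^'d \<Rightarrow> (real^'d) measure) \<Rightarrow> (nat \<Rightarrow> real^'d) measure
    \<Rightarrow> (real \<Rightarrow> real) \<Rightarrow> (nat \<Rightarrow> real^'d) \<Rightarrow> (nat \<Rightarrow> real) \<Rightarrow> nat \<Rightarrow> nat \<Rightarrow> real^'d \<Rightarrow> real" where
  "Uid g disc \<kappa> \<mu> \<sigma> a b K N x0 =
     max (g x0) (disc * condE \<kappa> 0 (Pid g disc \<kappa> \<mu> \<sigma> a b K N 1) x0)"

text \<open>Implementable algorithm on samples xs i n (path i, time n), i < m.
  pemp_aux ... j = (p_{N-j}^i)_i.\<close>
primrec pemp_aux :: "(real^'d \<Rightarrow> real) \<Rightarrow> real \<Rightarrow> (real \<Rightarrow> real) \<Rightarrow> (nat \<Rightarrow> real^'d) \<Rightarrow> (nat \<Rightarrow> real)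
    \<Rightarrow> nat \<Rightarrow> nat \<Rightarrow> nat \<Rightarrow> (nat \<Rightarrow> nat \<Rightarrow> real^'d) \<Rightarrow> nat \<Rightarrow> (nat \<Rightarrow> real)" where
  "pemp_aux g disc \<sigma> a b K N m xs 0 = (\<lambda>i. g (xs i N))"
| "pemp_aux g disc \<sigma> a b K N m xs (Suc j) =
    (let n = N - Suc j;
         v = pemp_aux g disc \<sigma> a b K N m xs j;
         loss = (\<lambda>\<theta>. (\<Sum>i<m. (v i - PhiK \<sigma> a b K \<theta> (xs i n))\<^sup>2) / real m);
         \<theta>h = (SOME \<theta>. \<forall>\<theta>'. loss \<theta> \<le> loss \<theta>')
     in (\<lambda>i. if g (xs i n) \<ge> disc * PhiK \<sigma> a b K \<theta>h (xs i n) then g (xs i n) else disc * v i))"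

definition Uemp :: "(real^'d \<Rightarrow> real) \<Rightarrow> real \<Rightarrow> (real \<Rightarrow> real) \<Rightarrow> (nat \<Rightarrow> real^'d) \<Rightarrow> (nat \<Rightarrow> real)
    \<Rightarrow> nat \<Rightarrow> nat \<Rightarrow> real^'d \<Rightarrow> nat \<Rightarrow> (nat \<Rightarrow> nat \<Rightarrow> real^'d) \<Rightarrow> real" where
  "Uemp g disc \<sigma> a b K N x0 m xs =
     max (g x0) ((\<Sum>i<m. disc * pemp_aux g disc \<sigma> a b K N m xs (N - 1) i) / real m)"

end

theory Submission
  imports Defs "HOL-Real_Asymp.Real_Asymp"
begin

text \<open>
  Let \<open>V n\<close> be the discounted payoff along a path when stopping from time \<open>n\<close> on is decided by the
  idealized regressions. By the Markov property, the conditional expectation of \<open>V n\<close> given the past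
  is \<open>P n\<close>, so the idealized regression is also the projection of \<open>V (n + 1)\<close>. Backward induction on
  \<open>n\<close> shows that, almost surely, the sample mean of the distances between the empirical values and
  \<open>V n\<close> tends to \<open>0\<close>. For the step, expand the difference of the empirical and the idealized fit in
  an orthonormal basis of the span: the normal equations are a linear system whose matrix tends to the
  identity and whose right-hand side tends to \<open>0\<close> by the law of large numbers, so the fits are
  uniformly close on the samples. The decisions can then differ only near a tie, and the contribution
  of near ties is small by the no-tie hypothesis and dominated convergence. All the averages involved
  have finite second moments, so the strong law is only needed in that case, where it follows
  from the convergence along squares of nonnegative averages.
\<close>

section \<open>Strong law of large numbers with finite second moments\<close>

text \<open>The obstacle is dependence. Through the fitted coefficients every empirical value
  depends on all sampled paths, so no law of large numbers applies to these values directly.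
  \<open>V n\<close> is a fixed function of one path, and its values on the samples are i.i.d. Limit
  theorems are applied only to fixed functions of this kind; everything else is a deterministic
  estimate along one realized sequence of samples. The implementable scheme regresses realized
  values, not conditional expectations, so its limiting counterpart must carry realized values as
  well and cannot be \<open>P n\<close> itself. The basis functions may be linearly dependent modulo
  null sets, so fitted coefficients need not converge. Only fitted values are compared, and the
  orthonormal system supplies coordinates in which they are well determined. Closeness is measured
  by mean absolute distance. Since the activation is bounded, this is strong enough to control the
  right-hand side of the normal equations, and it is reproduced by the stopping update, so the
  induction closes.\<close>

lemma average_tendsto_of_squares:
  fixes x :: "nat \<Rightarrow> real"
  assumes nonneg: "\<And>i. x i \<ge> 0"
    and lim: "(\<lambda>k. (\<Sum>i<(Suc k)\<^sup>2. x i) / (real (Suc k))\<^sup>2) \<longlonglongrightarrow> c"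
  shows "(\<lambda>m. (\<Sum>i<m. x i) / real m) \<longlonglongrightarrow> c"
proof -
  define T where "T m = (\<Sum>i<m. x i)" for m
  \<comment> \<open>The integer square root places \<open>m\<close> between
    \<open>(r m)\<^sup>2\<close> and \<open>(Suc (r m))\<^sup>2\<close>. Partial sums of nonnegative
    terms increase, so the average at \<open>m\<close> is squeezed between the averages at these
    squares, up to the ratio of the two squares, which tends to 1.\<close>
  define r where "r m = nat \<lfloor>sqrt (real m)\<rfloor>" for m
  have T_mono: "T m \<le> T n" if "m \<le> n" for m n
    unfolding T_def using that nonneg by (intro sum_mono2) auto
  have T_nonneg: "T m \<ge> 0" for m
    unfolding T_def by (simp add: nonneg sum_nonneg)
  have sq: "(\<lambda>k. T (k\<^sup>2) / (real k)\<^sup>2) \<longlonglongrightarrow> c"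
    using lim unfolding T_def by (subst (asm) filterlim_sequentially_Suc)
  have lower: "(\<lambda>k. (T (k\<^sup>2) / (real k)\<^sup>2) * ((real k)\<^sup>2 / (real (Suc k))\<^sup>2)) \<longlonglongrightarrow> c * 1"
    by (intro tendsto_mult sq) real_asymp
  have sq1: "(\<lambda>k. T ((Suc k)\<^sup>2) / (real (Suc k))\<^sup>2) \<longlonglongrightarrow> c"
    using lim unfolding T_def .
  have upper: "(\<lambda>k. (T ((Suc k)\<^sup>2) / (real (Suc k))\<^sup>2) * ((real (Suc k))\<^sup>2 / (real k)\<^sup>2)) \<longlonglongrightarrow> c * 1"
    by (intro tendsto_mult sq1) real_asymp
  have r_lim: "filterlim r at_top sequentially"
    unfolding r_def
    by real_asymp
  have bounds: "(r m)\<^sup>2 \<le> m \<and> m \<le> (Suc (r m))\<^sup>2 \<and> r m > 0" if "m \<ge> 1" for m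
  proof -
    have 1: "real (r m) \<le> sqrt (real m)" "sqrt (real m) \<le> real (Suc (r m))"
      unfolding r_def by (simp, simp) (metis add.commute real_of_int_floor_add_one_ge)
    have "real ((r m)\<^sup>2) \<le> real m"
      using power_mono[OF 1(1), of 2] by simp
    moreover have "real m \<le> real ((Suc (r m))\<^sup>2)"
      using power_mono[OF 1(2), of 2] by (simp del: of_nat_Suc)
    moreover have "r m > 0"
      using that unfolding r_def by simp
    ultimately show ?thesis
      by linarith
  qed
  have "(\<lambda>m. T m / real m) \<longlonglongrightarrow> c * 1"
  proof (rule tendsto_sandwich[OF _ _ filterlim_compose[OF lower r_lim] filterlim_compose[OF upper r_lim]])
    have "T ((r m)\<^sup>2) / (real (r m))\<^sup>2 * ((real (r m))\<^sup>2 / (real (Suc (r m)))\<^sup>2) \<le> T m / real m" if "m \<ge> 1" for m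
    proof -
      have "real m \<le> (real (Suc (r m)))\<^sup>2"
        using bounds[OF that] by (metis of_nat_le_iff of_nat_power)
      then have "T ((r m)\<^sup>2) / (real (Suc (r m)))\<^sup>2 \<le> T m / real m"
        using bounds[OF that] that T_mono[of "(r m)\<^sup>2" m] T_nonneg by (intro frac_le) auto
      then show ?thesis
        using bounds[OF that] by simp
    qed
    then show "\<forall>\<^sub>F m in sequentially. T ((r m)\<^sup>2) / (real (r m))\<^sup>2 * ((real (r m))\<^sup>2 / (real (Suc (r m)))\<^sup>2) \<le> T m / real m"
      by (rule eventually_sequentiallyI)
    have "T m / real m \<le> T ((Suc (r m))\<^sup>2) / (real (Suc (r m)))\<^sup>2 * ((real (Suc (r m)))\<^sup>2 / (real (r m))\<^sup>2)" if "m \<ge> 1" for m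
    proof -
      have "(real (r m))\<^sup>2 \<le> real m"
        using bounds[OF that] by (metis of_nat_le_iff of_nat_power)
      then have "T m / real m \<le> T ((Suc (r m))\<^sup>2) / (real (r m))\<^sup>2"
        using bounds[OF that] that T_mono[of m "(Suc (r m))\<^sup>2"] T_nonneg by (intro frac_le) auto
      then show ?thesis
        by (simp del: of_nat_Suc)
    qed
    then show "\<forall>\<^sub>F m in sequentially. T m / real m \<le> T ((Suc (r m))\<^sup>2) / (real (Suc (r m)))\<^sup>2 * ((real (Suc (r m)))\<^sup>2 / (real (r m))\<^sup>2)"
      by (rule eventually_sequentiallyI)
  qed
  then show ?thesis
    unfolding T_def by simp
qed

text \<open>Expanding the square gives a double sum in which independence kills the off-diagonal
  terms; each of the \<open>m\<close> diagonal terms is the variance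
  \<open>d - c\<^sup>2\<close>.\<close>

lemma (in prob_space) second_moment_centred_sum:
  fixes X :: "nat \<Rightarrow> 'a \<Rightarrow> real"
  assumes indep: "indep_vars (\<lambda>_. borel) X UNIV"
    and sq: "\<And>i. integrable M (\<lambda>\<omega>. (X i \<omega>)\<^sup>2)"
    and mean: "\<And>i. expectation (X i) = c"
    and second: "\<And>i. expectation (\<lambda>\<omega>. (X i \<omega>)\<^sup>2) = d"
  shows "integrable M (\<lambda>\<omega>. (\<Sum>i<m. X i \<omega> - c)\<^sup>2)"
    and "expectation (\<lambda>\<omega>. (\<Sum>i<m. X i \<omega> - c)\<^sup>2) = real m * (d - c\<^sup>2)"
proof -
  have X_meas [measurable]: "X i \<in> borel_measurable M" for i
    using indep by (auto simp: indep_vars_def)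
  have X_int: "integrable M (X i)" for i
    using sq[of i] by (rule square_integrable_imp_integrable[rotated]) simp
  define Z where "Z i \<omega> = X i \<omega> - c" for i \<omega>
  have Z_int: "integrable M (Z i)" for i
    unfolding Z_def using X_int by simp
  have Z_mean: "expectation (Z i) = 0" for i
    unfolding Z_def using X_int mean by (simp add: prob_space)
  have Z_indep: "indep_vars (\<lambda>_. borel) Z UNIV"
    unfolding Z_def by (rule indep_vars_compose2[OF indep]) auto
  have ZZ: "integrable M (\<lambda>\<omega>. Z i \<omega> * Z j \<omega>) \<and>
      expectation (\<lambda>\<omega>. Z i \<omega> * Z j \<omega>) = (if i = j then d - c\<^sup>2 else 0)" for i j
  proof (cases "i = j")
    case True
    have *: "(\<lambda>\<omega>. Z i \<omega> * Z j \<omega>) = (\<lambda>\<omega>. (X i \<omega>)\<^sup>2 - 2 * c * X i \<omega> + c\<^sup>2)"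
      by (simp add: Z_def True power2_eq_square algebra_simps fun_eq_iff)
    show ?thesis
      unfolding * using True sq X_int mean second by (simp add: prob_space power2_eq_square)
  next
    case False
    have ind: "indep_vars (\<lambda>_. borel) Z {i, j}"
      by (rule indep_vars_subset[OF Z_indep]) simp
    show ?thesis
      using indep_vars_lebesgue_integral[OF _ ind Z_int] indep_vars_integrable[OF _ ind Z_int]
        Z_mean False by simp
  qed
  have eq: "(\<lambda>\<omega>. (\<Sum>i<m. X i \<omega> - c)\<^sup>2) = (\<lambda>\<omega>. \<Sum>i<m. \<Sum>j<m. Z i \<omega> * Z j \<omega>)"
    by (simp add: Z_def power2_eq_square sum_product)
  show "integrable M (\<lambda>\<omega>. (\<Sum>i<m. X i \<omega> - c)\<^sup>2)"
    unfolding eq using ZZ by auto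
  show "expectation (\<lambda>\<omega>. (\<Sum>i<m. X i \<omega> - c)\<^sup>2) = real m * (d - c\<^sup>2)"
    unfolding eq using ZZ by (subst Bochner_Integration.integral_sum)
      (auto simp: Bochner_Integration.integral_sum)
qed

text \<open>Along the squares the mean squared error of the average is
  \<open>(d - c\<^sup>2) / (Suc k)\<^sup>2\<close>, which is summable. Hence the squared errors have
  an almost surely finite sum and tend to 0; nonnegativity then fills the gaps between consecutive
  squares.\<close>

theorem (in prob_space) slln_nonneg:
  fixes X :: "nat \<Rightarrow> 'a \<Rightarrow> real"
  assumes indep: "indep_vars (\<lambda>_. borel) X UNIV"
    and nonneg: "\<And>i \<omega>. X i \<omega> \<ge> 0"
    and sq: "\<And>i. integrable M (\<lambda>\<omega>. (X i \<omega>)\<^sup>2)"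
    and mean: "\<And>i. expectation (X i) = c"
    and second: "\<And>i. expectation (\<lambda>\<omega>. (X i \<omega>)\<^sup>2) = d"
  shows "AE \<omega> in M. (\<lambda>m. (\<Sum>i<m. X i \<omega>) / real m) \<longlonglongrightarrow> c"
proof -
  have X_meas [measurable]: "X i \<in> borel_measurable M" for i
    using indep by (auto simp: indep_vars_def)
  define D where "D k \<omega> = (\<Sum>i<(Suc k)\<^sup>2. X i \<omega> - c) / (real (Suc k))\<^sup>2" for k \<omega>
  note moment = second_moment_centred_sum[OF indep sq mean second]
  have D_eq: "(D k \<omega>)\<^sup>2 = (\<Sum>i<(Suc k)\<^sup>2. X i \<omega> - c)\<^sup>2 / (real (Suc k)) ^ 4" for k \<omega>
    unfolding D_def by (simp add: power_divide flip: power_mult)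
  have D_int: "integrable M (\<lambda>\<omega>. (D k \<omega>)\<^sup>2)" for k
    unfolding D_eq using moment(1) by auto
  have D_exp: "expectation (\<lambda>\<omega>. (D k \<omega>)\<^sup>2) = (d - c\<^sup>2) * (1 / (real (Suc k))\<^sup>2)" for k
  proof -
    have "expectation (\<lambda>\<omega>. (D k \<omega>)\<^sup>2) = (real (Suc k))\<^sup>2 * (d - c\<^sup>2) / (real (Suc k)) ^ 4"
      unfolding D_eq using moment(2)[of "(Suc k)\<^sup>2"] by (simp only: integral_divide_zero of_nat_power)
    then show ?thesis
      by (simp add: power4_eq_xxxx power2_eq_square del: of_nat_Suc)
  qed
  have [measurable]: "D k \<in> borel_measurable M" for k
    unfolding D_def by measurable
  have "(\<integral>\<^sup>+\<omega>. (\<Sum>k. ennreal ((D k \<omega>)\<^sup>2)) \<partial>M) = (\<Sum>k. \<integral>\<^sup>+\<omega>. ennreal ((D k \<omega>)\<^sup>2) \<partial>M)"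
    by (rule nn_integral_suminf) measurable
  also have "\<dots> = (\<Sum>k. ennreal ((d - c\<^sup>2) * (1 / (real (Suc k))\<^sup>2)))"
    using D_int by (simp add: nn_integral_eq_integral D_exp)
  also have "\<dots> \<noteq> \<infinity>"
  proof -
    have "summable (\<lambda>k. 1 / (real (Suc k))\<^sup>2)"
      using inverse_squares_sums sums_summable by fastforce
    then have "summable (\<lambda>k. (d - c\<^sup>2) * (1 / (real (Suc k))\<^sup>2))"
      by (rule summable_mult)
    moreover have "(d - c\<^sup>2) * (1 / (real (Suc k))\<^sup>2) \<ge> 0" for k
      unfolding D_exp[symmetric] by simp
    ultimately show ?thesis
      by (metis ennreal_suminf_neq_top infinity_ennreal_def)
  qed
  finally have "AE \<omega> in M. (\<Sum>k. ennreal ((D k \<omega>)\<^sup>2)) \<noteq> \<infinity>"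
    by (intro nn_integral_PInf_AE) auto
  then show ?thesis
  proof (rule AE_mp, intro AE_I2 impI)
    fix \<omega> assume "(\<Sum>k. ennreal ((D k \<omega>)\<^sup>2)) \<noteq> \<infinity>"
    then have "summable (\<lambda>k. (D k \<omega>)\<^sup>2)"
      by (intro summable_suminf_not_top) auto
    then have "(\<lambda>k. (D k \<omega>)\<^sup>2) \<longlonglongrightarrow> 0"
      by (rule summable_LIMSEQ_zero)
    then have "(\<lambda>k. D k \<omega>) \<longlonglongrightarrow> 0"
      by (simp add: power_tendsto_0_iff)
    then have "(\<lambda>k. D k \<omega> + c) \<longlonglongrightarrow> 0 + c"
      by (intro tendsto_intros)
    moreover have "D k \<omega> + c = (\<Sum>i<(Suc k)\<^sup>2. X i \<omega>) / (real (Suc k))\<^sup>2" for k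
      unfolding D_def by (simp add: sum_subtractf field_simps del: of_nat_Suc)
    ultimately show "(\<lambda>m. (\<Sum>i<m. X i \<omega>) / real m) \<longlonglongrightarrow> c"
      using nonneg by (intro average_tendsto_of_squares) simp_all
  qed
qed

text \<open>A signed function is the difference of its positive and negative parts, both of which
  are square integrable if the function is. The common law \<open>L'\<close> is a separate variable
  so that it can later be the path law \<open>\<mu>\<close>.\<close>

theorem (in prob_space) slln_sample:
  fixes Y :: "nat \<Rightarrow> 'a \<Rightarrow> 'b" and f :: "'b \<Rightarrow> real"
  assumes indep: "indep_vars (\<lambda>_. L) Y UNIV"
    and distr: "\<And>i. distr M L (Y i) = L'"
    and f [measurable]: "f \<in> borel_measurable L"
    and sq: "integrable L' (\<lambda>x. (f x)\<^sup>2)"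
  shows "AE \<omega> in M. (\<lambda>m. (\<Sum>i<m. f (Y i \<omega>)) / real m) \<longlonglongrightarrow> (\<integral>x. f x \<partial>L')"
proof -
  have Y_meas [measurable]: "Y i \<in> M \<rightarrow>\<^sub>M L" for i
    using indep by (auto simp: indep_vars_def)
  have nonneg_case: "AE \<omega> in M. (\<lambda>m. (\<Sum>i<m. h (Y i \<omega>)) / real m) \<longlonglongrightarrow> (\<integral>x. h x \<partial>L')"
    if h [measurable]: "h \<in> borel_measurable L" and h0: "\<And>x. h x \<ge> 0" and hsq: "integrable L' (\<lambda>x. (h x)\<^sup>2)" for h :: "'b \<Rightarrow> real"
  proof (rule slln_nonneg)
    show "indep_vars (\<lambda>_. borel) (\<lambda>i \<omega>. h (Y i \<omega>)) UNIV"
      by (rule indep_vars_compose2[OF indep]) auto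
    show "integrable M (\<lambda>\<omega>. (h (Y i \<omega>))\<^sup>2)" for i
      using hsq unfolding distr[of i, symmetric] by (subst (asm) integrable_distr_eq) auto
    show "expectation (\<lambda>\<omega>. h (Y i \<omega>)) = (\<integral>x. h x \<partial>L')" for i
      unfolding distr[of i, symmetric] by (subst integral_distr) auto
    show "expectation (\<lambda>\<omega>. (h (Y i \<omega>))\<^sup>2) = (\<integral>x. (h x)\<^sup>2 \<partial>L')" for i
      unfolding distr[of i, symmetric] by (subst integral_distr) auto
  qed (use h0 in auto)
  have sets_L' [measurable_cong]: "sets L' = sets L"
    unfolding distr[of 0, symmetric] by simp
  interpret L': prob_space L'
    unfolding distr[of 0, symmetric] by (rule prob_space_distr) simp
  have sqp: "integrable L' (\<lambda>x. (max 0 (f x))\<^sup>2)" "integrable L' (\<lambda>x. (max 0 (- f x))\<^sup>2)"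
    by (rule Bochner_Integration.integrable_bound[OF sq]; auto simp: max_def intro!: AE_I2)+
  have ip: "integrable L' (\<lambda>x. max 0 (f x))" "integrable L' (\<lambda>x. max 0 (- f x))"
    by (auto intro: L'.square_integrable_imp_integrable[OF _ sqp(1)] L'.square_integrable_imp_integrable[OF _ sqp(2)])
  have split: "f x = max 0 (f x) - max 0 (- f x)" for x
    by auto
  have int: "(\<integral>x. f x \<partial>L') = (\<integral>x. max 0 (f x) \<partial>L') - (\<integral>x. max 0 (- f x) \<partial>L')"
    by (subst Bochner_Integration.integral_diff[OF ip, symmetric]) (simp flip: split)
  have "AE \<omega> in M. (\<lambda>m. (\<Sum>i<m. max 0 (f (Y i \<omega>))) / real m) \<longlonglongrightarrow> (\<integral>x. max 0 (f x) \<partial>L')"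
    by (rule nonneg_case) (use sqp in auto)
  moreover have "AE \<omega> in M. (\<lambda>m. (\<Sum>i<m. max 0 (- f (Y i \<omega>))) / real m) \<longlonglongrightarrow> (\<integral>x. max 0 (- f x) \<partial>L')"
    by (rule nonneg_case) (use sqp in auto)
  ultimately show ?thesis
  proof eventually_elim
    case (elim \<omega>)
    have "(\<lambda>m. (\<Sum>i<m. f (Y i \<omega>)) / real m) = (\<lambda>m. (\<Sum>i<m. max 0 (f (Y i \<omega>))) / real m - (\<Sum>i<m. max 0 (- f (Y i \<omega>))) / real m)"
      by (subst split) (simp add: sum_subtractf diff_divide_distrib)
    then show ?case
      unfolding int using tendsto_diff[OF elim] by simp
  qed
qed

section \<open>Least squares\<close>

lemma integrable_mult_of_square_integrable:
  fixes f g :: "'a \<Rightarrow> real"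
  assumes [measurable]: "f \<in> borel_measurable M" "g \<in> borel_measurable M"
    and sq: "integrable M (\<lambda>x. (f x)\<^sup>2)" "integrable M (\<lambda>x. (g x)\<^sup>2)"
  shows "integrable M (\<lambda>x. f x * g x)"
proof (rule Bochner_Integration.integrable_bound[OF Bochner_Integration.integrable_add[OF sq]])
  show "AE x in M. norm (f x * g x) \<le> norm ((f x)\<^sup>2 + (g x)\<^sup>2)"
  proof (rule AE_I2)
    fix x
    have "2 * (\<bar>f x\<bar> * \<bar>g x\<bar>) \<le> (f x)\<^sup>2 + (g x)\<^sup>2"
      using sum_squares_bound[of "\<bar>f x\<bar>" "\<bar>g x\<bar>"] by simp
    moreover have "\<bar>f x\<bar> * \<bar>g x\<bar> \<ge> 0"
      by simp
    ultimately show "norm (f x * g x) \<le> norm ((f x)\<^sup>2 + (g x)\<^sup>2)"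
      unfolding real_norm_def abs_mult by linarith
  qed
qed measurable

lemma square_integrable_diff:
  fixes f g :: "'a \<Rightarrow> real"
  assumes "f \<in> borel_measurable M" "g \<in> borel_measurable M"
    and "integrable M (\<lambda>x. (f x)\<^sup>2)" "integrable M (\<lambda>x. (g x)\<^sup>2)"
  shows "integrable M (\<lambda>x. (f x - g x)\<^sup>2)"
proof -
  have "integrable M (\<lambda>x. (f x)\<^sup>2 - 2 * (f x * g x) + (g x)\<^sup>2)"
    using assms by (intro Bochner_Integration.integrable_add Bochner_Integration.integrable_diff
        integrable_mult_right integrable_mult_of_square_integrable)
  then show ?thesis
    by (simp add: power2_eq_square algebra_simps)
qed

text \<open>The domain is an arbitrary type because the same algebra is used for functions of a
  position, functions of a whole path, and functions of a sample index; in the last case the measure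
  is a counting measure.\<close>

definition lincomb :: "(nat \<Rightarrow> 'a \<Rightarrow> real) \<Rightarrow> nat \<Rightarrow> (nat \<Rightarrow> real) \<Rightarrow> 'a \<Rightarrow> real" where
  "lincomb F K \<theta> x = (\<Sum>k<K. \<theta> k * F k x)"

lemma lincomb_add: "lincomb F K (\<lambda>k. \<theta> k + \<eta> k) x = lincomb F K \<theta> x + lincomb F K \<eta> x"
  unfolding lincomb_def by (simp add: distrib_right sum.distrib)

lemma lincomb_diff: "lincomb F K (\<lambda>k. \<theta> k - \<eta> k) x = lincomb F K \<theta> x - lincomb F K \<eta> x"
  unfolding lincomb_def by (simp add: left_diff_distrib sum_subtractf)

lemma lincomb_scale: "lincomb F K (\<lambda>k. c * \<theta> k) x = c * lincomb F K \<theta> x"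
  unfolding lincomb_def by (simp add: sum_distrib_left mult.assoc)

lemma lincomb_lincomb:
  "lincomb (\<lambda>j. lincomb F K (t j)) r \<eta> x = lincomb F K (\<lambda>k. \<Sum>j<r. \<eta> j * t j k) x"
  unfolding lincomb_def sum_distrib_left sum_distrib_right mult.assoc by (rule sum.swap)

lemma lincomb_single:
  assumes "k < K"
  shows "lincomb F K (\<lambda>i. if i = k then c else 0) x = c * F k x"
  using assms unfolding lincomb_def by (simp add: if_distrib[of "\<lambda>z. z * _"] cong: if_cong)

lemma lincomb_borel_measurable:
  assumes "\<And>k. k < K \<Longrightarrow> F k \<in> borel_measurable M"
  shows "lincomb F K \<theta> \<in> borel_measurable M"
  unfolding lincomb_def using assms by (intro borel_measurable_sum borel_measurable_times) auto

lemma lincomb_square_integrable: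
  assumes F: "\<And>k. k < K \<Longrightarrow> F k \<in> borel_measurable M" "\<And>k. k < K \<Longrightarrow> integrable M (\<lambda>x. (F k x)\<^sup>2)"
  shows "integrable M (\<lambda>x. (lincomb F K \<theta> x)\<^sup>2)"
proof -
  have eq: "(lincomb F K \<theta> x)\<^sup>2 = (\<Sum>i<K. \<Sum>j<K. (\<theta> i * \<theta> j) * (F i x * F j x))" for x
    unfolding lincomb_def power2_eq_square sum_product by (simp add: ac_simps)
  show ?thesis
    unfolding eq using F
    by (intro Bochner_Integration.integrable_sum integrable_mult_right integrable_mult_of_square_integrable) auto
qed

lemma lincomb_bounded:
  assumes "\<And>k. k < K \<Longrightarrow> \<bar>F k x\<bar> \<le> B"
  shows "\<bar>lincomb F K \<theta> x\<bar> \<le> (\<Sum>k<K. \<bar>\<theta> k\<bar>) * B"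
proof -
  have "\<bar>lincomb F K \<theta> x\<bar> \<le> (\<Sum>k<K. \<bar>\<theta> k * F k x\<bar>)"
    unfolding lincomb_def by (rule sum_abs)
  also have "\<dots> \<le> (\<Sum>k<K. \<bar>\<theta> k\<bar> * B)"
    unfolding abs_mult using assms by (intro sum_mono mult_left_mono) auto
  finally show ?thesis
    by (simp add: sum_distrib_right)
qed

lemma orthogonal_lincomb:
  fixes R :: "'a \<Rightarrow> real"
  assumes R: "R \<in> borel_measurable M" "integrable M (\<lambda>x. (R x)\<^sup>2)"
    and F: "\<And>k. k < K \<Longrightarrow> F k \<in> borel_measurable M" "\<And>k. k < K \<Longrightarrow> integrable M (\<lambda>x. (F k x)\<^sup>2)"
    and orth: "\<And>k. k < K \<Longrightarrow> (\<integral>x. R x * F k x \<partial>M) = 0"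
  shows "(\<integral>x. R x * lincomb F K \<theta> x \<partial>M) = 0"
proof -
  have int: "integrable M (\<lambda>x. R x * F k x)" if "k < K" for k
    using R F that by (intro integrable_mult_of_square_integrable) auto
  have "(\<integral>x. R x * lincomb F K \<theta> x \<partial>M) = (\<integral>x. (\<Sum>k<K. \<theta> k * (R x * F k x)) \<partial>M)"
    unfolding lincomb_def sum_distrib_left by (simp add: ac_simps)
  also have "\<dots> = (\<Sum>k<K. \<theta> k * (\<integral>x. R x * F k x \<partial>M))"
    using int by (subst Bochner_Integration.integral_sum) auto
  finally show ?thesis
    using orth by simp
qed

section \<open>Orthonormal systems and solvability of the normal equations\<close>

lemma bessel_residual_orthogonal:
  fixes e :: "nat \<Rightarrow> 'a \<Rightarrow> real"
  assumes J: "J \<in> borel_measurable M" "integrable M (\<lambda>x. (J x)\<^sup>2)"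
    and e: "\<And>j. j < r \<Longrightarrow> e j \<in> borel_measurable M" "\<And>j. j < r \<Longrightarrow> integrable M (\<lambda>x. (e j x)\<^sup>2)"
    and ortho: "\<And>i j. i < r \<Longrightarrow> j < r \<Longrightarrow> (\<integral>x. e i x * e j x \<partial>M) = (if i = j then 1 else 0)"
    and l: "l < r"
  shows "(\<integral>x. (J x - lincomb e r (\<lambda>j. \<integral>y. J y * e j y \<partial>M) x) * e l x \<partial>M) = 0"
proof -
  have int: "integrable M (\<lambda>x. J x * e l x)" "j < r \<Longrightarrow> integrable M (\<lambda>x. e j x * e l x)" for j
    using J e l by (auto intro: integrable_mult_of_square_integrable)
  have "(\<integral>x. (J x - lincomb e r (\<lambda>j. \<integral>y. J y * e j y \<partial>M) x) * e l x \<partial>M)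
      = (\<integral>x. J x * e l x - (\<Sum>j<r. (\<integral>y. J y * e j y \<partial>M) * (e j x * e l x)) \<partial>M)"
    unfolding lincomb_def by (simp add: algebra_simps sum_distrib_left sum_distrib_right)
  also have "\<dots> = (\<integral>x. J x * e l x \<partial>M) - (\<Sum>j<r. (\<integral>y. J y * e j y \<partial>M) * (\<integral>x. e j x * e l x \<partial>M))"
    using int by (subst Bochner_Integration.integral_diff) (auto simp: Bochner_Integration.integral_sum)
  also have "\<dots> = 0"
  proof -
    have "(\<Sum>j<r. (\<integral>y. J y * e j y \<partial>M) * (\<integral>x. e j x * e l x \<partial>M)) = (\<Sum>j<r. if j = l then \<integral>y. J y * e j y \<partial>M else 0)"
      using l ortho by (intro sum.cong) auto
    then show ?thesis
      using l by simp
  qed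
  finally show ?thesis .
qed

text \<open>No independence is assumed, so the length \<open>r\<close> of the orthonormal system may be smaller than \<open>K\<close>.\<close>

lemma gram_schmidt:
  fixes F :: "nat \<Rightarrow> 'a \<Rightarrow> real"
  assumes F: "\<And>k. k < K \<Longrightarrow> F k \<in> borel_measurable M" "\<And>k. k < K \<Longrightarrow> integrable M (\<lambda>x. (F k x)\<^sup>2)"
  shows "\<exists>r t c. (\<forall>i<r. \<forall>j<r. (\<integral>x. lincomb F K (t i) x * lincomb F K (t j) x \<partial>M) = (if i = j then 1 else 0)) \<and>
      (AE x in M. \<forall>k<K. F k x = lincomb (\<lambda>j. lincomb F K (t j)) r (c k) x)"
  using F
proof (induction K)
  case 0
  show ?case
    by (intro exI[of _ 0]) simp
next
  case (Suc K)
  have IH_prems: "\<And>k. k < K \<Longrightarrow> F k \<in> borel_measurable M" "\<And>k. k < K \<Longrightarrow> integrable M (\<lambda>x. (F k x)\<^sup>2)"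
    using Suc.prems by auto
  obtain r t c where
    ortho: "\<forall>i<r. \<forall>j<r. (\<integral>x. lincomb F K (t i) x * lincomb F K (t j) x \<partial>M) = (if i = j then 1 else 0)"
    and rep: "AE x in M. \<forall>k<K. F k x = lincomb (\<lambda>j. lincomb F K (t j)) r (c k) x"
    using Suc.IH IH_prems by blast
  \<comment> \<open>The coefficients from the induction hypothesis are arbitrary from index
    \<open>K\<close> on; padding with 0 keeps the old elements unchanged when they are read as
    combinations of \<open>Suc K\<close> functions.\<close>
  define t0 where "t0 j k = (if k < K then t j k else 0)" for j k
  define e where "e j = lincomb F K (t j)" for j
  have e_alt: "lincomb F (Suc K) (t0 j) = e j" for j
    unfolding e_def lincomb_def t0_def by (auto simp: fun_eq_iff)
  have e_meas [measurable]: "e j \<in> borel_measurable M" for j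
    unfolding e_def using Suc.prems by (intro lincomb_borel_measurable) auto
  have e_sq: "integrable M (\<lambda>x. (e j x)\<^sup>2)" for j
    unfolding e_def using Suc.prems by (intro lincomb_square_integrable) auto
  have FK [measurable]: "F K \<in> borel_measurable M" and FK_sq: "integrable M (\<lambda>x. (F K x)\<^sup>2)"
    using Suc.prems by auto
  define p where "p j = (\<integral>y. F K y * e j y \<partial>M)" for j
  define u where "u x = F K x - lincomb e r p x" for x
  have u_orth: "(\<integral>x. u x * e l x \<partial>M) = 0" if "l < r" for l
    unfolding u_def p_def using FK FK_sq e_meas e_sq ortho that
    by (intro bessel_residual_orthogonal) (auto simp: e_def)
  define tu where "tu k = (if k = K then 1 else 0) - (\<Sum>j<r. p j * t0 j k)" for k
  have u_alt: "lincomb F (Suc K) tu = u"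
  proof
    fix x
    have "lincomb F (Suc K) tu x = lincomb F (Suc K) (\<lambda>k. if k = K then 1 else 0) x
        - lincomb F (Suc K) (\<lambda>k. \<Sum>j<r. p j * t0 j k) x"
      unfolding tu_def by (rule lincomb_diff)
    then show "lincomb F (Suc K) tu x = u x"
      unfolding lincomb_lincomb[symmetric] e_alt u_def by (simp add: lincomb_single)
  qed
  have u_meas [measurable]: "u \<in> borel_measurable M"
    unfolding u_alt[symmetric] using Suc.prems by (intro lincomb_borel_measurable) auto
  have u_sq: "integrable M (\<lambda>x. (u x)\<^sup>2)"
    unfolding u_alt[symmetric] using Suc.prems by (intro lincomb_square_integrable) auto
  define q where "q = (\<integral>x. (u x)\<^sup>2 \<partial>M)"
  have q_nonneg: "q \<ge> 0"
    unfolding q_def by simp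
  \<comment> \<open>The squared norm \<open>q\<close> of the residual decides whether the system
    grows. If it is 0, then \<open>F K\<close> is almost everywhere a combination of the old
    elements and only its expansion is recorded; otherwise the normalized residual is appended at
    index \<open>r\<close>.\<close>
  show ?case
  proof (cases "q = 0")
    case True
    then have "AE x in M. (u x)\<^sup>2 = 0"
      unfolding q_def using u_sq by (subst (asm) integral_nonneg_eq_0_iff_AE) auto
    with rep have "AE x in M. \<forall>k<Suc K. F k x = lincomb e r (if k = K then p else c k) x"
      by eventually_elim (auto simp: less_Suc_eq u_def e_def[abs_def])
    then have "AE x in M. \<forall>k<Suc K. F k x =
        lincomb (\<lambda>j. lincomb F (Suc K) (t0 j)) r (if k = K then p else c k) x"
      by (simp add: e_alt)
    moreover have "\<forall>i<r. \<forall>j<r. (\<integral>x. lincomb F (Suc K) (t0 i) x * lincomb F (Suc K) (t0 j) x \<partial>M) = (if i = j then 1 else 0)"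
      using ortho by (simp add: e_alt e_def)
    ultimately show ?thesis
      by (intro exI conjI)
  next
    case False
    with q_nonneg have q: "q > 0"
      by simp
    define t' where "t' = t0(r := (\<lambda>k. inverse (sqrt q) * tu k))"
    define e' where "e' = e(r := (\<lambda>x. inverse (sqrt q) * u x))"
    have e'_alt: "lincomb F (Suc K) (t' j) = e' j" for j
      by (auto simp: t'_def e'_def e_alt lincomb_scale u_alt fun_eq_iff)
    have "(\<integral>x. (inverse (sqrt q) * u x) * (inverse (sqrt q) * u x) \<partial>M) = (\<integral>x. inverse q * (u x)\<^sup>2 \<partial>M)"
      using q by (intro Bochner_Integration.integral_cong) (auto simp: power2_eq_square field_simps)
    also have "\<dots> = 1"
      using q by (simp add: q_def[symmetric])
    finally have norm1: "(\<integral>x. (inverse (sqrt q) * u x) * (inverse (sqrt q) * u x) \<partial>M) = 1" .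
    have "(\<integral>x. e' i x * e' j x \<partial>M) = (if i = j then 1 else 0)" if "i < Suc r" "j < Suc r" for i j
    proof -
      have mixed: "(\<integral>x. inverse (sqrt q) * u x * e l x \<partial>M) = 0" if "l < r" for l
        using u_orth[OF that] by (simp add: mult.assoc)
      then have mixed': "(\<integral>x. e l x * (inverse (sqrt q) * u x) \<partial>M) = 0" if "l < r" for l
        using that by (simp add: mult.commute)
      consider "i = r" "j = r" | "i = r" "j < r" | "i < r" "j = r" | "i < r" "j < r"
        using \<open>i < Suc r\<close> \<open>j < Suc r\<close> by linarith
      then show ?thesis
      proof cases
        case 1
        then show ?thesis
          unfolding e'_def using norm1 by simp
      next
        case 2
        then show ?thesis
          unfolding e'_def using mixed by simp
      next
        case 3
        then show ?thesis
          unfolding e'_def using mixed' by simp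
      next
        case 4
        then show ?thesis
          using ortho by (simp add: e'_def e_def)
      qed
    qed
    then have "\<forall>i<Suc r. \<forall>j<Suc r. (\<integral>x. lincomb F (Suc K) (t' i) x * lincomb F (Suc K) (t' j) x \<partial>M) = (if i = j then 1 else 0)"
      by (simp add: e'_alt)
    \<comment> \<open>The old functions get coefficient 0 on the new element. \<open>F K\<close> is
      its projection plus \<open>u\<close>, and \<open>u\<close> is \<open>sqrt q\<close> times the
      new element.\<close>
    moreover have "AE x in M. \<forall>k<Suc K. F k x =
        lincomb e' (Suc r) (if k = K then p(r := sqrt q) else (c k)(r := 0)) x"
      using rep
    proof eventually_elim
      case (elim x)
      have step: "lincomb e' (Suc r) (v(r := w)) x = lincomb e r v x + w * (inverse (sqrt q) * u x)" for v w
        unfolding lincomb_def e'_def by simp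
      have cancel: "sqrt q * (inverse (sqrt q) * z) = z" for z
        using q by simp
      show ?case
        using elim by (auto simp: less_Suc_eq step cancel u_def e_def[abs_def])
    qed
    then have "AE x in M. \<forall>k<Suc K. F k x =
        lincomb (\<lambda>j. lincomb F (Suc K) (t' j)) (Suc r) (if k = K then p(r := sqrt q) else (c k)(r := 0)) x"
      by (simp add: e'_alt)
    ultimately show ?thesis
      by (intro exI conjI)
  qed
qed

text \<open>The Bessel expansion in an orthonormal system leaves a residual orthogonal to the
  system, hence to every \<open>F k\<close>, since these are almost everywhere combinations of the
  system. Rewriting the expansion in the original functions gives \<open>\<theta>\<close>, with no
  rank condition on them.\<close>

lemma normal_equations_solvable:
  fixes F :: "nat \<Rightarrow> 'a \<Rightarrow> real"
  assumes F: "\<And>k. k < K \<Longrightarrow> F k \<in> borel_measurable M" "\<And>k. k < K \<Longrightarrow> integrable M (\<lambda>x. (F k x)\<^sup>2)"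
    and J: "J \<in> borel_measurable M" "integrable M (\<lambda>x. (J x)\<^sup>2)"
  shows "\<exists>\<theta>. \<forall>k<K. (\<integral>x. (J x - lincomb F K \<theta> x) * F k x \<partial>M) = 0"
proof -
  obtain r t c where
    ortho: "\<forall>i<r. \<forall>j<r. (\<integral>x. lincomb F K (t i) x * lincomb F K (t j) x \<partial>M) = (if i = j then 1 else 0)"
    and rep: "AE x in M. \<forall>k<K. F k x = lincomb (\<lambda>j. lincomb F K (t j)) r (c k) x"
    using gram_schmidt[of K F M, OF F] by blast
  define e where "e j = lincomb F K (t j)" for j
  have e: "e j \<in> borel_measurable M" "integrable M (\<lambda>x. (e j x)\<^sup>2)" for j
    unfolding e_def using F by (auto intro: lincomb_borel_measurable lincomb_square_integrable)
  define p where "p j = (\<integral>y. J y * e j y \<partial>M)" for j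
  define R where "R x = J x - lincomb e r p x" for x
  have R_alt: "R x = J x - lincomb F K (\<lambda>k. \<Sum>j<r. p j * t j k) x" for x
    unfolding R_def e_def[abs_def] lincomb_lincomb ..
  have [measurable]: "lincomb e r p \<in> borel_measurable M" "J \<in> borel_measurable M"
    using e J by (auto intro: lincomb_borel_measurable)
  have R: "R \<in> borel_measurable M" "integrable M (\<lambda>x. (R x)\<^sup>2)"
    unfolding R_def using e J by (auto intro!: square_integrable_diff lincomb_square_integrable)
  have R_orth: "(\<integral>x. R x * e l x \<partial>M) = 0" if "l < r" for l
    unfolding R_def p_def using that ortho J e by (intro bessel_residual_orthogonal) (auto simp: e_def)
  have "(\<integral>x. R x * F k x \<partial>M) = 0" if "k < K" for k
  proof -
    have [measurable]: "F k \<in> borel_measurable M" "lincomb e r (c k) \<in> borel_measurable M" "R \<in> borel_measurable M"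
      using F(1)[OF that] e R by (auto intro: lincomb_borel_measurable)
    have "(\<integral>x. R x * F k x \<partial>M) = (\<integral>x. R x * lincomb e r (c k) x \<partial>M)"
    proof (rule integral_cong_AE)
      show "AE x in M. R x * F k x = R x * lincomb e r (c k) x"
        using rep by eventually_elim (simp add: e_def[abs_def] that)
    qed measurable
    also have "\<dots> = 0"
      using R e R_orth by (intro orthogonal_lincomb) auto
    finally show ?thesis .
  qed
  then show ?thesis
    unfolding R_alt by blast
qed

section \<open>Minimizers of the quadratic loss and their normal equations\<close>

lemma integral_square_add_scaled:
  fixes R H :: "'a \<Rightarrow> real"
  assumes "R \<in> borel_measurable M" "integrable M (\<lambda>x. (R x)\<^sup>2)"
    and "H \<in> borel_measurable M" "integrable M (\<lambda>x. (H x)\<^sup>2)"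
  shows "(\<integral>x. (R x - s * H x)\<^sup>2 \<partial>M) =
    (\<integral>x. (R x)\<^sup>2 \<partial>M) - 2 * s * (\<integral>x. R x * H x \<partial>M) + s\<^sup>2 * (\<integral>x. (H x)\<^sup>2 \<partial>M)"
proof -
  have "(\<integral>x. (R x - s * H x)\<^sup>2 \<partial>M) = (\<integral>x. (R x)\<^sup>2 - 2 * s * (R x * H x) + s\<^sup>2 * (H x)\<^sup>2 \<partial>M)"
    by (simp add: power2_eq_square algebra_simps)
  moreover have "integrable M (\<lambda>x. R x * H x)"
    using assms by (intro integrable_mult_of_square_integrable)
  ultimately show ?thesis
    using assms by simp
qed

text \<open>For a solution of the normal equations the mixed term vanishes, so any other loss
  exceeds its loss by the squared norm of the difference of the fits. Existence is what turns the
  \<open>SOME\<close> in both algorithms into a genuine minimizer.\<close>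

lemma least_squares_ex:
  fixes F :: "nat \<Rightarrow> 'a \<Rightarrow> real"
  assumes F: "\<And>k. k < K \<Longrightarrow> F k \<in> borel_measurable M" "\<And>k. k < K \<Longrightarrow> integrable M (\<lambda>x. (F k x)\<^sup>2)"
    and J: "J \<in> borel_measurable M" "integrable M (\<lambda>x. (J x)\<^sup>2)"
  shows "\<exists>\<theta>. \<forall>\<theta>'. (\<integral>x. (J x - lincomb F K \<theta> x)\<^sup>2 \<partial>M) \<le> (\<integral>x. (J x - lincomb F K \<theta>' x)\<^sup>2 \<partial>M)"
proof -
  obtain \<theta> where orth: "\<And>k. k < K \<Longrightarrow> (\<integral>x. (J x - lincomb F K \<theta> x) * F k x \<partial>M) = 0"
    using normal_equations_solvable[of K F M J, OF F J] by blast
  have L: "lincomb F K \<eta> \<in> borel_measurable M" "integrable M (\<lambda>x. (lincomb F K \<eta> x)\<^sup>2)" for \<eta>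
    using F by (auto intro: lincomb_borel_measurable lincomb_square_integrable)
  have R: "(\<lambda>x. J x - lincomb F K \<theta> x) \<in> borel_measurable M" "integrable M (\<lambda>x. (J x - lincomb F K \<theta> x)\<^sup>2)"
    using L J by (auto intro!: square_integrable_diff)
  have "(\<integral>x. (J x - lincomb F K \<theta> x)\<^sup>2 \<partial>M) \<le> (\<integral>x. (J x - lincomb F K \<theta>' x)\<^sup>2 \<partial>M)" for \<theta>'
  proof -
    let ?H = "lincomb F K (\<lambda>k. \<theta>' k - \<theta> k)"
    have "(\<integral>x. (J x - lincomb F K \<theta>' x)\<^sup>2 \<partial>M) = (\<integral>x. ((J x - lincomb F K \<theta> x) - 1 * ?H x)\<^sup>2 \<partial>M)"
      by (simp add: lincomb_diff)
    also have "\<dots> = (\<integral>x. (J x - lincomb F K \<theta> x)\<^sup>2 \<partial>M) + (\<integral>x. (?H x)\<^sup>2 \<partial>M)"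
      unfolding integral_square_add_scaled[OF R L] using orthogonal_lincomb[of _ M K F, OF R F orth] by simp
    finally show ?thesis
      by simp
  qed
  then show ?thesis
    by blast
qed

text \<open>First-order condition: moving the minimizer by \<open>s\<close> in the direction
  \<open>\<eta>\<close> cannot lower the loss, and a linear term dominated by a quadratic one for
  every \<open>s\<close> must vanish.\<close>

lemma least_squares_normal:
  fixes F :: "nat \<Rightarrow> 'a \<Rightarrow> real"
  assumes F: "\<And>k. k < K \<Longrightarrow> F k \<in> borel_measurable M" "\<And>k. k < K \<Longrightarrow> integrable M (\<lambda>x. (F k x)\<^sup>2)"
    and J: "J \<in> borel_measurable M" "integrable M (\<lambda>x. (J x)\<^sup>2)"
    and min: "\<And>\<theta>'. (\<integral>x. (J x - lincomb F K \<theta> x)\<^sup>2 \<partial>M) \<le> (\<integral>x. (J x - lincomb F K \<theta>' x)\<^sup>2 \<partial>M)"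
  shows "(\<integral>x. (J x - lincomb F K \<theta> x) * lincomb F K \<eta> x \<partial>M) = 0"
proof -
  have L: "lincomb F K \<eta> \<in> borel_measurable M" "integrable M (\<lambda>x. (lincomb F K \<eta> x)\<^sup>2)" for \<eta>
    using F by (auto intro: lincomb_borel_measurable lincomb_square_integrable)
  have R: "(\<lambda>x. J x - lincomb F K \<theta> x) \<in> borel_measurable M" "integrable M (\<lambda>x. (J x - lincomb F K \<theta> x)\<^sup>2)"
    using L J by (auto intro!: square_integrable_diff)
  define A where "A = (\<integral>x. (J x - lincomb F K \<theta> x) * lincomb F K \<eta> x \<partial>M)"
  define B where "B = (\<integral>x. (lincomb F K \<eta> x)\<^sup>2 \<partial>M)"
  have "B \<ge> 0"
    unfolding B_def by simp
  have quad: "2 * s * A \<le> s\<^sup>2 * B" for s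
  proof -
    have "(\<integral>x. (J x - lincomb F K (\<lambda>k. \<theta> k + s * \<eta> k) x)\<^sup>2 \<partial>M)
        = (\<integral>x. ((J x - lincomb F K \<theta> x) - s * lincomb F K \<eta> x)\<^sup>2 \<partial>M)"
      by (simp add: lincomb_add lincomb_scale algebra_simps)
    then show ?thesis
      using min[of "\<lambda>k. \<theta> k + s * \<eta> k"] integral_square_add_scaled[OF R L, of s]
      by (simp add: A_def B_def)
  qed
  \<comment> \<open>The minimizing choice of \<open>s\<close> would be \<open>A / B\<close>; adding
    1 to the denominator covers a direction of norm 0 as well and is still small enough to force
    \<open>A = 0\<close>.\<close>
  have "2 * (A / (B + 1)) * A \<le> (A / (B + 1))\<^sup>2 * B"
    by (rule quad)
  then have "2 * (B + 1) * A\<^sup>2 \<le> B * A\<^sup>2"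
    using \<open>B \<ge> 0\<close> by (simp add: power2_eq_square divide_simps) (auto simp: algebra_simps)
  then have "(B + 2) * A\<^sup>2 \<le> 0"
    by (simp add: algebra_simps)
  then have "A = 0"
    using \<open>B \<ge> 0\<close> by (simp add: mult_le_0_iff)
  then show ?thesis
    unfolding A_def .
qed

lemma empirical_least_squares:
  fixes F :: "nat \<Rightarrow> nat \<Rightarrow> real" and v :: "nat \<Rightarrow> real"
  assumes "\<theta> = (SOME \<theta>. \<forall>\<theta>'. (\<Sum>i<m. (v i - lincomb F K \<theta> i)\<^sup>2) / real m \<le> (\<Sum>i<m. (v i - lincomb F K \<theta>' i)\<^sup>2) / real m)"
    and "m > 0"
  shows "(\<Sum>i<m. (v i - lincomb F K \<theta> i) * lincomb F K \<eta> i) = 0"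
proof -
  \<comment> \<open>Counting measure turns sums over the sample into integrals under which every
    function is integrable, so the integral statements on least squares apply to the empirical
    problem.\<close>
  let ?M = "count_space {..<m}"
  have int: "(\<integral>i. h i \<partial>?M) = (\<Sum>i<m. h i)" "integrable ?M h" for h :: "nat \<Rightarrow> real"
    by (auto simp: lebesgue_integral_count_space_finite integrable_count_space)
  have "\<exists>\<theta>. \<forall>\<theta>'. (\<integral>i. (v i - lincomb F K \<theta> i)\<^sup>2 \<partial>?M) \<le> (\<integral>i. (v i - lincomb F K \<theta>' i)\<^sup>2 \<partial>?M)"
    by (rule least_squares_ex) (auto simp: int)
  then have "\<exists>\<theta>. \<forall>\<theta>'. (\<Sum>i<m. (v i - lincomb F K \<theta> i)\<^sup>2) / real m \<le> (\<Sum>i<m. (v i - lincomb F K \<theta>' i)\<^sup>2) / real m"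
    unfolding int by (meson divide_right_mono of_nat_0_le_iff)
  from someI_ex[OF this] have "(\<Sum>i<m. (v i - lincomb F K \<theta> i)\<^sup>2) \<le> (\<Sum>i<m. (v i - lincomb F K \<theta>' i)\<^sup>2)" for \<theta>'
    unfolding assms(1)[symmetric] using \<open>m > 0\<close> by (simp add: divide_le_cancel)
  then have "(\<integral>i. (v i - lincomb F K \<theta> i) * lincomb F K \<eta> i \<partial>?M) = 0"
    by (intro least_squares_normal) (auto simp: int)
  then show ?thesis
    by (simp add: int)
qed

text \<open>Moving the identity part of \<open>G m\<close> to the other side bounds the l1 norm
  \<open>s m\<close> of the unknowns by that of \<open>b m\<close> plus \<open>D m * s m\<close>.
  Once \<open>D m < 1 / 2\<close>, the last term is absorbed, which costs a factor 2. No inverse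
  matrix and no prior bound on the unknowns enter.\<close>

lemma perturbed_identity_system_tendsto_0:
  fixes \<eta> :: "nat \<Rightarrow> nat \<Rightarrow> real"
  assumes G: "\<And>j l. j < r \<Longrightarrow> l < r \<Longrightarrow> (\<lambda>m. G m j l) \<longlonglongrightarrow> (if j = l then 1 else 0)"
    and b: "\<And>j. j < r \<Longrightarrow> (\<lambda>m. b m j) \<longlonglongrightarrow> 0"
    and sys: "\<forall>\<^sub>F m in sequentially. \<forall>j<r. (\<Sum>l<r. G m j l * \<eta> m l) = b m j"
  shows "(\<lambda>m. \<Sum>j<r. \<bar>\<eta> m j\<bar>) \<longlonglongrightarrow> 0"
proof -
  define D where "D m = (\<Sum>j<r. \<Sum>l<r. \<bar>G m j l - (if j = l then 1 else 0)\<bar>)" for m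
  define s where "s m = (\<Sum>j<r. \<bar>\<eta> m j\<bar>)" for m
  have s0: "s m \<ge> 0" for m
    unfolding s_def by (simp add: sum_nonneg)
  have "D \<longlonglongrightarrow> (\<Sum>j<r. \<Sum>l<r. \<bar>(if j = l then 1 else 0) - (if j = l then 1 else 0)\<bar>)"
    unfolding D_def by (intro tendsto_sum tendsto_rabs tendsto_diff tendsto_const G) auto
  then have "D \<longlonglongrightarrow> 0"
    by simp
  then have D_small: "\<forall>\<^sub>F m in sequentially. D m < 1 / 2"
    by (rule order_tendstoD) simp
  have "(\<lambda>m. 2 * (\<Sum>j<r. \<bar>b m j\<bar>)) \<longlonglongrightarrow> 2 * (\<Sum>j<r. \<bar>0\<bar>)"
    by (intro tendsto_mult tendsto_const tendsto_sum tendsto_rabs b) auto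
  then have upper: "(\<lambda>m. 2 * (\<Sum>j<r. \<bar>b m j\<bar>)) \<longlonglongrightarrow> 0"
    by simp
  have "\<forall>\<^sub>F m in sequentially. s m \<le> 2 * (\<Sum>j<r. \<bar>b m j\<bar>)"
    using D_small sys
  proof eventually_elim
    case (elim m)
    have "\<bar>\<eta> m j\<bar> \<le> \<bar>b m j\<bar> + (\<Sum>l<r. \<bar>G m j l - (if j = l then 1 else 0)\<bar>) * s m" if "j < r" for j
    proof -
      have "(\<Sum>l<r. (G m j l - (if j = l then 1 else 0)) * \<eta> m l) = b m j - \<eta> m j"
        using elim(2) that by (simp add: left_diff_distrib sum_subtractf if_distrib[of "\<lambda>z. z * _"] cong: if_cong)
      then have "\<bar>\<eta> m j\<bar> \<le> \<bar>b m j\<bar> + \<bar>\<Sum>l<r. (G m j l - (if j = l then 1 else 0)) * \<eta> m l\<bar>"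
        by linarith
      also have "\<bar>\<Sum>l<r. (G m j l - (if j = l then 1 else 0)) * \<eta> m l\<bar>
          \<le> (\<Sum>l<r. \<bar>G m j l - (if j = l then 1 else 0)\<bar> * \<bar>\<eta> m l\<bar>)"
        unfolding abs_mult[symmetric] by (rule sum_abs)
      also have "\<dots> \<le> (\<Sum>l<r. \<bar>G m j l - (if j = l then 1 else 0)\<bar> * s m)"
        unfolding s_def by (intro sum_mono mult_left_mono member_le_sum) auto
      finally show ?thesis
        by (simp add: sum_distrib_right)
    qed
    then have "s m \<le> (\<Sum>j<r. \<bar>b m j\<bar> + (\<Sum>l<r. \<bar>G m j l - (if j = l then 1 else 0)\<bar>) * s m)"
      unfolding s_def[of m] by (intro sum_mono) (auto simp: s_def)
    also have "\<dots> = (\<Sum>j<r. \<bar>b m j\<bar>) + D m * s m"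
      unfolding D_def by (simp add: sum.distrib sum_distrib_right)
    also have "D m * s m \<le> 1 / 2 * s m"
      using elim(1) s0 by (intro mult_right_mono) auto
    finally show ?case
      by simp
  qed
  then have "s \<longlonglongrightarrow> 0"
    by (intro tendsto_sandwich[OF _ _ tendsto_const upper]) (auto simp: s0)
  then show ?thesis
    unfolding s_def .
qed

section \<open>Regression and stopping on a fixed sample\<close>

lemma PhiK_eq_lincomb: "PhiK \<sigma> a b K \<theta> = lincomb (rbf \<sigma> a b) K \<theta>"
  by (simp add: PhiK_def lincomb_def fun_eq_iff)

text \<open>\<open>F k i\<close> is the value of the \<open>k\<close>-th basis function at the \<open>i\<close>-th sample point; \<open>p m\<close> are the
  targets of the regression on the first \<open>m\<close> samples.\<close>

lemma regression_uniformly_close: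
  fixes F :: "nat \<Rightarrow> nat \<Rightarrow> real" and p :: "nat \<Rightarrow> nat \<Rightarrow> real" and V :: "nat \<Rightarrow> real"
  assumes rep: "\<And>i k. k < K \<Longrightarrow> F k i = lincomb (\<lambda>j. lincomb F K (t j)) r (c k) i"
    and bound: "\<And>i j. j < r \<Longrightarrow> \<bar>lincomb F K (t j) i\<bar> \<le> B"
    and gram: "\<And>j l. j < r \<Longrightarrow> l < r \<Longrightarrow>
      (\<lambda>m. (\<Sum>i<m. lincomb F K (t j) i * lincomb F K (t l) i) / real m) \<longlonglongrightarrow> (if j = l then 1 else 0)"
    and resid: "\<And>j. j < r \<Longrightarrow>
      (\<lambda>m. (\<Sum>i<m. (V i - lincomb F K \<theta> i) * lincomb F K (t j) i) / real m) \<longlonglongrightarrow> 0"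
    and close: "(\<lambda>m. (\<Sum>i<m. \<bar>p m i - V i\<bar>) / real m) \<longlonglongrightarrow> 0"
    and normal: "\<And>m \<eta>. m > 0 \<Longrightarrow> (\<Sum>i<m. (p m i - lincomb F K (\<theta>h m) i) * lincomb F K \<eta> i) = 0"
  shows "\<exists>s. s \<longlonglongrightarrow> 0 \<and> (\<forall>m i. \<bar>lincomb F K (\<theta>h m) i - lincomb F K \<theta> i\<bar> \<le> s m)"
proof -
  define E where "E j = lincomb F K (t j)" for j
  \<comment> \<open>These are coordinates of the difference of the two fits in the system
    \<open>E\<close>. They tend to 0, whereas \<open>\<theta>h m\<close> itself need not converge
    when the basis functions are dependent.\<close>
  define \<eta> where "\<eta> m j = (\<Sum>k<K. (\<theta>h m k - \<theta> k) * c k j)" for m j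
  have diff: "lincomb F K (\<theta>h m) i - lincomb F K \<theta> i = lincomb E r (\<eta> m) i" for m i
  proof -
    have "lincomb F K (\<theta>h m) i - lincomb F K \<theta> i = (\<Sum>k<K. (\<theta>h m k - \<theta> k) * lincomb E r (c k) i)"
      unfolding lincomb_diff[symmetric] E_def[abs_def]
      by (subst lincomb_def) (intro sum.cong refl, simp add: rep)
    also have "\<dots> = lincomb E r (\<eta> m) i"
      using lincomb_lincomb[of E r c K "\<lambda>k. \<theta>h m k - \<theta> k" i] unfolding \<eta>_def by (simp add: lincomb_def)
    finally show ?thesis .
  qed
  define G where "G m j l = (\<Sum>i<m. E j i * E l i) / real m" for m j l
  define b where "b m j = (\<Sum>i<m. (p m i - lincomb F K \<theta> i) * E j i) / real m" for m j
  have coeff: "(\<lambda>m. \<Sum>j<r. \<bar>\<eta> m j\<bar>) \<longlonglongrightarrow> 0"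
  proof (rule perturbed_identity_system_tendsto_0)
    show "(\<lambda>m. G m j l) \<longlonglongrightarrow> (if j = l then 1 else 0)" if "j < r" "l < r" for j l
      unfolding G_def E_def using that by (rule gram)
    show "(\<lambda>m. b m j) \<longlonglongrightarrow> 0" if j: "j < r" for j
    proof -
      have eq: "b m j = (\<Sum>i<m. (p m i - V i) * E j i) / real m + (\<Sum>i<m. (V i - lincomb F K \<theta> i) * E j i) / real m" for m
        unfolding b_def add_divide_distrib[symmetric] sum.distrib[symmetric] by (simp add: algebra_simps)
      \<comment> \<open>Replacing the true targets \<open>V\<close> by \<open>p m\<close> perturbs
        the right-hand side by at most \<open>B\<close> times their mean absolute distance.\<close>
      have "(\<lambda>m. (\<Sum>i<m. (p m i - V i) * E j i) / real m) \<longlonglongrightarrow> 0"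
      proof (rule Lim_null_comparison)
        have "norm ((\<Sum>i<m. (p m i - V i) * E j i) / real m) \<le> B * ((\<Sum>i<m. \<bar>p m i - V i\<bar>) / real m)" for m
        proof -
          have "\<bar>\<Sum>i<m. (p m i - V i) * E j i\<bar> \<le> (\<Sum>i<m. \<bar>p m i - V i\<bar> * \<bar>E j i\<bar>)"
            unfolding abs_mult[symmetric] by (rule sum_abs)
          also have "\<dots> \<le> (\<Sum>i<m. \<bar>p m i - V i\<bar> * B)"
            using bound j by (intro sum_mono mult_left_mono) (auto simp: E_def)
          also have "\<dots> = B * (\<Sum>i<m. \<bar>p m i - V i\<bar>)"
            by (simp add: sum_distrib_left mult.commute)
          finally show ?thesis
            using divide_right_mono[of _ _ "real m"] by simp
        qed
        then show "\<forall>\<^sub>F m in sequentially. norm ((\<Sum>i<m. (p m i - V i) * E j i) / real m) \<le> B * ((\<Sum>i<m. \<bar>p m i - V i\<bar>) / real m)"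
          by simp
        show "(\<lambda>m. B * ((\<Sum>i<m. \<bar>p m i - V i\<bar>) / real m)) \<longlonglongrightarrow> 0"
          using tendsto_mult[OF tendsto_const close, of B] by simp
      qed
      from tendsto_add[OF this resid[OF j]] show ?thesis
        unfolding eq by (simp add: E_def)
    qed
    \<comment> \<open>The Gram matrix applied to \<open>\<eta> m\<close> is the difference of the
      fits tested against \<open>E j\<close>. Writing it as a difference of residuals, the empirical
      residual drops out by the normal equation.\<close>
    have "(\<Sum>l<r. G m j l * \<eta> m l) = b m j" if m: "m > 0" and j: "j < r" for m j
    proof -
      have "(\<Sum>l<r. G m j l * \<eta> m l) = (\<Sum>i<m. E j i * (\<Sum>l<r. \<eta> m l * E l i)) / real m"
        unfolding G_def sum_distrib_left sum_divide_distrib sum_distrib_right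
        by (subst sum.swap) (simp add: ac_simps)
      also have "\<dots> = (\<Sum>i<m. (lincomb F K (\<theta>h m) i - lincomb F K \<theta> i) * E j i) / real m"
        unfolding diff by (simp add: lincomb_def mult.commute)
      also have "\<dots> = (\<Sum>i<m. (p m i - lincomb F K \<theta> i) * E j i) / real m - (\<Sum>i<m. (p m i - lincomb F K (\<theta>h m) i) * E j i) / real m"
        unfolding diff_divide_distrib[symmetric] sum_subtractf[symmetric] by (simp add: algebra_simps)
      also have "\<dots> = b m j"
        using normal[OF m] unfolding b_def E_def by simp
      finally show ?thesis .
    qed
    then show "\<forall>\<^sub>F m in sequentially. \<forall>j<r. (\<Sum>l<r. G m j l * \<eta> m l) = b m j"
      by (intro eventually_mono[OF eventually_gt_at_top[of 0]]) auto
  qed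
  show ?thesis
  proof (intro exI conjI allI)
    show "(\<lambda>m. (\<Sum>j<r. \<bar>\<eta> m j\<bar>) * B) \<longlonglongrightarrow> 0"
      using tendsto_mult[OF coeff tendsto_const, of B] by simp
    show "\<bar>lincomb F K (\<theta>h m) i - lincomb F K \<theta> i\<bar> \<le> (\<Sum>j<r. \<bar>\<eta> m j\<bar>) * B" for m i
      unfolding diff using bound by (intro lincomb_bounded) (auto simp: E_def)
  qed
qed

text \<open>Close fitted values only lead to different decisions where \<open>d * f i\<close> is close to \<open>g i\<close>.\<close>

lemma stopping_update_close:
  fixes p :: "nat \<Rightarrow> nat \<Rightarrow> real" and V f g :: "nat \<Rightarrow> real" and d :: real
  assumes d: "d > 0"
    and s: "s \<longlonglongrightarrow> 0" and fh: "\<And>m i. \<bar>fh m i - f i\<bar> \<le> s m"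
    and close: "(\<lambda>m. (\<Sum>i<m. \<bar>p m i - V i\<bar>) / real m) \<longlonglongrightarrow> 0"
    and tie: "\<And>k. (\<lambda>m. (\<Sum>i<m. if \<bar>d * f i - g i\<bar> \<le> 1 / real (Suc k) then \<bar>g i - d * V i\<bar> else 0) / real m) \<longlonglongrightarrow> z k"
    and z: "z \<longlonglongrightarrow> 0"
  shows "(\<lambda>m. (\<Sum>i<m. \<bar>(if d * fh m i \<le> g i then g i else d * p m i) - (if d * f i \<le> g i then g i else d * V i)\<bar>) / real m) \<longlonglongrightarrow> 0"
    (is "?L \<longlonglongrightarrow> 0")
proof (rule LIMSEQ_I)
  fix e :: real assume e: "e > 0"
  define W where "W k i = (if \<bar>d * f i - g i\<bar> \<le> 1 / real (Suc k) then \<bar>g i - d * V i\<bar> else 0)" for k i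
  \<comment> \<open>The order of choices matters: \<open>k\<close> fixes the width of the tie
    window, with a limiting contribution below \<open>e / 2\<close>, and only then is
    \<open>m\<close> taken so large that the fits differ by less than that width.\<close>
  have "\<forall>\<^sub>F k in sequentially. z k < e / 2"
    using z e by (intro order_tendstoD) auto
  then obtain k where k: "z k < e / 2"
    by (auto simp: eventually_sequentially)
  have "(\<lambda>m. d * ((\<Sum>i<m. \<bar>p m i - V i\<bar>) / real m)) \<longlonglongrightarrow> d * 0"
    by (intro tendsto_mult tendsto_const close)
  then have "(\<lambda>m. d * ((\<Sum>i<m. \<bar>p m i - V i\<bar>) / real m) + (\<Sum>i<m. W k i) / real m) \<longlonglongrightarrow> d * 0 + z k"
    unfolding W_def by (intro tendsto_add tie)
  then have ev1: "\<forall>\<^sub>F m in sequentially. d * ((\<Sum>i<m. \<bar>p m i - V i\<bar>) / real m) + (\<Sum>i<m. W k i) / real m < e"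
    by (rule order_tendstoD) (use k e in simp)
  have "(\<lambda>m. d * s m) \<longlonglongrightarrow> d * 0"
    by (intro tendsto_mult tendsto_const s)
  then have ev2: "\<forall>\<^sub>F m in sequentially. d * s m < 1 / real (Suc k)"
    by (rule order_tendstoD) simp
  have "\<forall>\<^sub>F m in sequentially. norm (?L m - 0) < e"
    using ev1 ev2
  proof eventually_elim
    case (elim m)
    have "\<bar>(if d * fh m i \<le> g i then g i else d * p m i) - (if d * f i \<le> g i then g i else d * V i)\<bar>
        \<le> d * \<bar>p m i - V i\<bar> + W k i" (is "?l \<le> _") for i
    proof -
      have dp: "\<bar>d * p m i - d * V i\<bar> = d * \<bar>p m i - V i\<bar>"
        using d by (simp add: right_diff_distrib[symmetric] abs_mult)
      have W0: "W k i \<ge> 0"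
        by (simp add: W_def)
      show ?thesis
      proof (cases "d * fh m i \<le> g i \<longleftrightarrow> d * f i \<le> g i")
        case True
        then show ?thesis
          using dp W0 d by auto
      next
        case False
        \<comment> \<open>When the decisions differ, \<open>g i\<close> separates
          \<open>d * fh m i\<close> from \<open>d * f i\<close> and so lies in the window. One of
          the compared values is then \<open>g i\<close>; the other is \<open>d * V i\<close>, or
          \<open>d * p m i\<close>, which differs from \<open>d * V i\<close> by the first term of
          the bound.\<close>
        have "\<bar>d * fh m i - d * f i\<bar> = d * \<bar>fh m i - f i\<bar>"
          using d by (simp add: right_diff_distrib[symmetric] abs_mult)
        also have "\<dots> \<le> d * s m"
          using fh d by simp
        finally have "\<bar>d * f i - g i\<bar> \<le> 1 / real (Suc k)"
          using False elim(2) by linarith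
        then have W: "W k i = \<bar>g i - d * V i\<bar>"
          by (simp add: W_def)
        show ?thesis
          using False dp W by (auto simp: abs_if split: if_splits)
      qed
    qed
    then have "?L m \<le> (\<Sum>i<m. d * \<bar>p m i - V i\<bar> + W k i) / real m"
      by (intro divide_right_mono sum_mono) auto
    also have "\<dots> = d * ((\<Sum>i<m. \<bar>p m i - V i\<bar>) / real m) + (\<Sum>i<m. W k i) / real m"
      by (simp add: sum.distrib sum_distrib_left add_divide_distrib)
    also have "\<dots> < e"
      by (rule elim(1))
    finally show ?case
      by (simp add: sum_nonneg)
  qed
  then show "\<exists>m0. \<forall>m\<ge>m0. norm (?L m - 0) < e"
    by (simp add: eventually_sequentially)
qed

section \<open>Markov property\<close>

text \<open>Conditioning is on the entire past, expressed through events \<open>A\<close> of the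
  restricted path, while the kernel sees only the current position. The property is assumed on
  products of a past event and a future event and is extended to functions below.\<close>

locale markov_path_law =
  fixes \<mu> :: "(nat \<Rightarrow> real^'d) measure"
    and \<kappa> :: "nat \<Rightarrow> real^'d \<Rightarrow> (real^'d) measure"
    and N :: nat
  assumes law: "prob_space \<mu>" "sets \<mu> = sets (Pi\<^sub>M {..N} (\<lambda>_. (borel :: (real^'d) measure)))"
    and kernel: "\<forall>n<N. \<kappa> n \<in> borel \<rightarrow>\<^sub>M prob_algebra borel"
    and markov: "\<forall>n<N. \<forall>A\<in>sets (Pi\<^sub>M {..n} (\<lambda>_. (borel :: (real^'d) measure))). \<forall>B\<in>sets borel.
        emeasure \<mu> {\<omega>\<in>space \<mu>. restrict \<omega> {..n} \<in> A \<and> \<omega> (Suc n) \<in> B}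
        = (\<integral>\<^sup>+\<omega>. indicator A (restrict \<omega> {..n}) * emeasure (\<kappa> n (\<omega> n)) B \<partial>\<mu>)"
begin

sublocale prob_space \<mu>
  by (rule law(1))

lemma sets_\<mu> [measurable_cong]: "sets \<mu> = sets (Pi\<^sub>M {..N} (\<lambda>_. (borel :: (real^'d) measure)))"
  by (rule law(2))

lemma coord_measurable [measurable]: "n \<le> N \<Longrightarrow> (\<lambda>\<omega>. \<omega> n) \<in> \<mu> \<rightarrow>\<^sub>M borel"
  by (subst measurable_cong_sets[OF sets_\<mu> refl]) (rule measurable_component_singleton, simp)

lemma past_measurable [measurable]:
  "n \<le> N \<Longrightarrow> (\<lambda>\<omega>. restrict \<omega> {..n}) \<in> \<mu> \<rightarrow>\<^sub>M Pi\<^sub>M {..n} (\<lambda>_. (borel :: (real^'d) measure))"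
  by (subst measurable_cong_sets[OF sets_\<mu> refl]) (rule measurable_restrict_subset, simp)

lemma kernel_measurable: "n < N \<Longrightarrow> \<kappa> n \<in> borel \<rightarrow>\<^sub>M subprob_algebra borel"
  using kernel by (blast intro: measurable_prob_algebraD)

lemma
  assumes "n < N"
  shows prob_space_kernel: "prob_space (\<kappa> n x)"
    and sets_kernel_borel: "sets (\<kappa> n x) = sets borel"
  using measurable_space[of "\<kappa> n" borel "prob_algebra borel" x] kernel assms
  by (auto simp: space_prob_algebra)

lemma kernel_measurable_iff:
  "n < N \<Longrightarrow> h \<in> borel_measurable (\<kappa> n x) \<longleftrightarrow> h \<in> borel_measurable borel"
  by (rule arg_cong[where f = "\<lambda>A. h \<in> A"], rule measurable_cong_sets) (simp_all add: sets_kernel_borel)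

lemma kernel_nn_integral_measurable:
  assumes "n < N" and h: "h \<in> borel_measurable borel"
  shows "(\<lambda>x. \<integral>\<^sup>+y. h y \<partial>\<kappa> n x) \<in> borel_measurable borel"
  using measurable_compose[OF kernel_measurable[OF assms(1)] nn_integral_measurable_subprob_algebra[OF h]] .

lemma condE_measurable:
  assumes "n < N" and h: "h \<in> borel_measurable borel"
  shows "condE \<kappa> n h \<in> borel_measurable borel"
  unfolding condE_def
  using measurable_compose[OF kernel_measurable[OF assms(1)] integral_measurable_subprob_algebra[OF h]] .

text \<open>Monotone class argument in \<open>h\<close> with the past event fixed: indicators are
  the hypothesis, and scaling, sums and increasing limits pass through both the kernel and the path
  integral.\<close>

lemma markov_indicator:
  fixes h :: "real^'d \<Rightarrow> ennreal"
  assumes n: "n < N" and A: "A \<in> sets (Pi\<^sub>M {..n} (\<lambda>_. (borel :: (real^'d) measure)))"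
    and h: "h \<in> borel_measurable borel"
  shows "(\<integral>\<^sup>+\<omega>. indicator A (restrict \<omega> {..n}) * h (\<omega> (Suc n)) \<partial>\<mu>)
    = (\<integral>\<^sup>+\<omega>. indicator A (restrict \<omega> {..n}) * (\<integral>\<^sup>+y. h y \<partial>\<kappa> n (\<omega> n)) \<partial>\<mu>)"
proof -
  note [measurable] = A
  have [measurable]: "(\<lambda>\<omega>. \<omega> (Suc n)) \<in> \<mu> \<rightarrow>\<^sub>M borel" "(\<lambda>\<omega>. \<omega> n) \<in> \<mu> \<rightarrow>\<^sub>M borel"
      "(\<lambda>\<omega>. restrict \<omega> {..n}) \<in> \<mu> \<rightarrow>\<^sub>M Pi\<^sub>M {..n} (\<lambda>_. (borel :: (real^'d) measure))"
    using n by (auto intro: coord_measurable past_measurable)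
  note inner_meas [measurable] = kernel_nn_integral_measurable[OF n]
  define Q :: "(nat \<Rightarrow> real^'d) \<Rightarrow> ennreal" where "Q \<omega> = indicator A (restrict \<omega> {..n})" for \<omega>
  have [measurable]: "Q \<in> borel_measurable \<mu>"
    unfolding Q_def by measurable
  show ?thesis
    unfolding Q_def[symmetric] using h
  proof (induction rule: borel_measurable_induct)
    case (cong f g)
    then have "f = g"
      by auto
    with cong show ?case
      by simp
  next
    case (set B)
    note [measurable] = set
    have "(\<integral>\<^sup>+\<omega>. indicator A (restrict \<omega> {..n}) * indicator B (\<omega> (Suc n)) \<partial>\<mu>)
        = (\<integral>\<^sup>+\<omega>. indicator {\<omega>\<in>space \<mu>. restrict \<omega> {..n} \<in> A \<and> \<omega> (Suc n) \<in> B} \<omega> \<partial>\<mu>)"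
      by (intro nn_integral_cong) (auto simp: indicator_def)
    also have "\<dots> = emeasure \<mu> {\<omega>\<in>space \<mu>. restrict \<omega> {..n} \<in> A \<and> \<omega> (Suc n) \<in> B}"
      using A set by (intro nn_integral_indicator) measurable
    also have "\<dots> = (\<integral>\<^sup>+\<omega>. indicator A (restrict \<omega> {..n}) * emeasure (\<kappa> n (\<omega> n)) B \<partial>\<mu>)"
      using markov n A set by blast
    finally have "(\<integral>\<^sup>+\<omega>. indicator A (restrict \<omega> {..n}) * indicator B (\<omega> (Suc n)) \<partial>\<mu>)
        = (\<integral>\<^sup>+\<omega>. indicator A (restrict \<omega> {..n}) * emeasure (\<kappa> n (\<omega> n)) B \<partial>\<mu>)" .
    moreover have "(\<integral>\<^sup>+y. indicator B y \<partial>\<kappa> n x) = emeasure (\<kappa> n x) B" for x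
      using n set by (simp add: sets_kernel_borel)
    ultimately show ?case
      unfolding Q_def
      by (simp only:)
  next
    case (mult u c)
    note [measurable] = mult(1,2)
    have "(\<integral>\<^sup>+y. c * u y \<partial>\<kappa> n x) = c * (\<integral>\<^sup>+y. u y \<partial>\<kappa> n x)" for x
      using mult n by (intro nn_integral_cmult) (simp add: kernel_measurable_iff)
    then show ?case
      using mult.IH by (simp add: mult.left_commute[of _ c] nn_integral_cmult)
  next
    case (add u v)
    note [measurable] = add(1,4)
    have "(\<integral>\<^sup>+y. v y + u y \<partial>\<kappa> n x) = (\<integral>\<^sup>+y. v y \<partial>\<kappa> n x) + (\<integral>\<^sup>+y. u y \<partial>\<kappa> n x)" for x
      using add n by (intro nn_integral_add) (simp_all add: kernel_measurable_iff)
    moreover have "(\<lambda>\<omega>. Q \<omega> * (\<integral>\<^sup>+y. w y \<partial>\<kappa> n (\<omega> n))) \<in> borel_measurable \<mu>"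
      if "w \<in> borel_measurable borel" for w
      using inner_meas[OF that] by measurable
    ultimately show ?case
      using add by (simp add: distrib_left nn_integral_add)
  next
    case (seq U)
    note [measurable] = seq(1)
    have mono: "U i y \<le> U j y" if "i \<le> j" for i j y
      using seq that by (auto simp: incseq_def le_fun_def)
    have inner: "(\<integral>\<^sup>+y. (SUP i. U i) y \<partial>\<kappa> n x) = (SUP i. \<integral>\<^sup>+y. U i y \<partial>\<kappa> n x)" for x
      unfolding SUP_apply using seq n
      by (intro nn_integral_monotone_convergence_SUP) (simp_all add: kernel_measurable_iff)
    have "(\<integral>\<^sup>+\<omega>. Q \<omega> * (SUP i. U i) (\<omega> (Suc n)) \<partial>\<mu>)
        = (SUP i. \<integral>\<^sup>+\<omega>. Q \<omega> * U i (\<omega> (Suc n)) \<partial>\<mu>)"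
      unfolding SUP_apply SUP_mult_left_ennreal
      by (intro nn_integral_monotone_convergence_SUP) (auto simp: incseq_def le_fun_def intro: mult_left_mono mono)
    also have "\<dots> = (SUP i. \<integral>\<^sup>+\<omega>. Q \<omega> * (\<integral>\<^sup>+y. U i y \<partial>\<kappa> n (\<omega> n)) \<partial>\<mu>)"
      using seq.IH by simp
    also have "\<dots> = (\<integral>\<^sup>+\<omega>. Q \<omega> * (\<integral>\<^sup>+y. (SUP i. U i) y \<partial>\<kappa> n (\<omega> n)) \<partial>\<mu>)"
      unfolding inner SUP_mult_left_ennreal
      by (intro nn_integral_monotone_convergence_SUP[symmetric])
        (auto simp: incseq_def le_fun_def intro!: mult_left_mono nn_integral_mono mono)
    finally show ?case .
  qed
qed

text \<open>The extension from past events to past functions avoids a second induction. Both sides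
  integrate \<open>\<psi>\<close> against image measures on the past, of \<open>\<mu>\<close>
  weighted by \<open>h\<close> at the next position and by its kernel integral; these measures agree
  on all events by \<open>markov_indicator\<close>.\<close>

lemma markov_nn_integral:
  fixes h :: "real^'d \<Rightarrow> ennreal"
  assumes n: "n < N" and \<psi>: "\<psi> \<in> borel_measurable (Pi\<^sub>M {..n} (\<lambda>_. (borel :: (real^'d) measure)))"
    and h: "h \<in> borel_measurable borel"
  shows "(\<integral>\<^sup>+\<omega>. \<psi> (restrict \<omega> {..n}) * h (\<omega> (Suc n)) \<partial>\<mu>)
    = (\<integral>\<^sup>+\<omega>. \<psi> (restrict \<omega> {..n}) * (\<integral>\<^sup>+y. h y \<partial>\<kappa> n (\<omega> n)) \<partial>\<mu>)"
proof -
  have past [measurable]: "(\<lambda>\<omega>. restrict \<omega> {..n}) \<in> \<mu> \<rightarrow>\<^sub>M Pi\<^sub>M {..n} (\<lambda>_. (borel :: (real^'d) measure))"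
    and [measurable]: "(\<lambda>\<omega>. \<omega> (Suc n)) \<in> \<mu> \<rightarrow>\<^sub>M borel" "(\<lambda>\<omega>. \<omega> n) \<in> \<mu> \<rightarrow>\<^sub>M borel"
      "(\<lambda>x. \<integral>\<^sup>+y. h y \<partial>\<kappa> n x) \<in> borel_measurable borel" "h \<in> borel_measurable borel"
    using n h by (auto intro: kernel_nn_integral_measurable)
  have "nn_integral (distr (density \<mu> (\<lambda>\<omega>. h (\<omega> (Suc n)))) (Pi\<^sub>M {..n} (\<lambda>_. borel)) (\<lambda>\<omega>. restrict \<omega> {..n})) \<psi>
      = nn_integral (distr (density \<mu> (\<lambda>\<omega>. \<integral>\<^sup>+y. h y \<partial>\<kappa> n (\<omega> n))) (Pi\<^sub>M {..n} (\<lambda>_. borel)) (\<lambda>\<omega>. restrict \<omega> {..n})) \<psi>"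
  proof (rule arg_cong[where f = "\<lambda>M. nn_integral M \<psi>"], rule measure_eqI)
    fix A assume "A \<in> sets (distr (density \<mu> (\<lambda>\<omega>. h (\<omega> (Suc n)))) (Pi\<^sub>M {..n} (\<lambda>_. borel)) (\<lambda>\<omega>. restrict \<omega> {..n}))"
    then have A [measurable]: "A \<in> sets (Pi\<^sub>M {..n} (\<lambda>_. (borel :: (real^'d) measure)))"
      by simp
    have "emeasure (distr (density \<mu> f) (Pi\<^sub>M {..n} (\<lambda>_. borel)) (\<lambda>\<omega>. restrict \<omega> {..n})) A
        = (\<integral>\<^sup>+\<omega>. indicator A (restrict \<omega> {..n}) * f \<omega> \<partial>\<mu>)"
      if [measurable]: "f \<in> borel_measurable \<mu>" for f
      by (subst emeasure_distr, measurable)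
        (auto simp: emeasure_density indicator_def mult.commute intro!: nn_integral_cong)
    then show "emeasure (distr (density \<mu> (\<lambda>\<omega>. h (\<omega> (Suc n)))) (Pi\<^sub>M {..n} (\<lambda>_. borel)) (\<lambda>\<omega>. restrict \<omega> {..n})) A
      = emeasure (distr (density \<mu> (\<lambda>\<omega>. \<integral>\<^sup>+y. h y \<partial>\<kappa> n (\<omega> n))) (Pi\<^sub>M {..n} (\<lambda>_. borel)) (\<lambda>\<omega>. restrict \<omega> {..n})) A"
      using markov_indicator[OF n A h] by simp
  qed simp
  then show ?thesis
    using \<psi> by (simp add: nn_integral_distr nn_integral_density mult.commute)
qed

text \<open>The Markov property with \<open>\<psi> = 1\<close> shows that the kernel integral of the
  square of \<open>h\<close> has finite mean, so it is finite along almost every path. There the two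
  kinds of integral agree, and nonnegative variance bounds the square of \<open>condE\<close>.
  Elsewhere they may disagree, since a Bochner integral defaults to 0 where the nonnegative one is
  infinite.\<close>

lemma
  fixes h :: "real^'d \<Rightarrow> real"
  assumes n: "n < N" and h: "h \<in> borel_measurable borel" and h0: "\<And>x. h x \<ge> 0"
    and sq: "integrable \<mu> (\<lambda>\<omega>. (h (\<omega> (Suc n)))\<^sup>2)"
  shows condE_nn: "AE \<omega> in \<mu>. ennreal (condE \<kappa> n h (\<omega> n)) = (\<integral>\<^sup>+y. ennreal (h y) \<partial>\<kappa> n (\<omega> n))"
    and condE_square_integrable: "integrable \<mu> (\<lambda>\<omega>. (condE \<kappa> n h (\<omega> n))\<^sup>2)"
proof -
  note [measurable] = h condE_measurable[OF n h]
  have [measurable]: "(\<lambda>\<omega>. \<omega> (Suc n)) \<in> \<mu> \<rightarrow>\<^sub>M borel" "(\<lambda>\<omega>. \<omega> n) \<in> \<mu> \<rightarrow>\<^sub>M borel"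
    using n by auto
  have "(\<lambda>x. \<integral>\<^sup>+y. ennreal ((h y)\<^sup>2) \<partial>\<kappa> n x) \<in> borel_measurable borel"
    by (rule kernel_nn_integral_measurable[OF n]) measurable
  then have sq_meas: "(\<lambda>\<omega>. \<integral>\<^sup>+y. ennreal ((h y)\<^sup>2) \<partial>\<kappa> n (\<omega> n)) \<in> borel_measurable \<mu>"
    by measurable
  have "(\<integral>\<^sup>+\<omega>. (\<integral>\<^sup>+y. ennreal ((h y)\<^sup>2) \<partial>\<kappa> n (\<omega> n)) \<partial>\<mu>) = (\<integral>\<^sup>+\<omega>. ennreal ((h (\<omega> (Suc n)))\<^sup>2) \<partial>\<mu>)"
    using markov_nn_integral[OF n, of "\<lambda>_. 1" "\<lambda>y. ennreal ((h y)\<^sup>2)"] by simp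
  also have "\<dots> < \<infinity>"
    using sq by (simp add: integrable_iff_bounded)
  finally have fin: "(\<integral>\<^sup>+\<omega>. (\<integral>\<^sup>+y. ennreal ((h y)\<^sup>2) \<partial>\<kappa> n (\<omega> n)) \<partial>\<mu>) < \<infinity>" .
  then have AE_fin: "AE \<omega> in \<mu>. (\<integral>\<^sup>+y. ennreal ((h y)\<^sup>2) \<partial>\<kappa> n (\<omega> n)) \<noteq> \<infinity>"
    by (intro nn_integral_PInf_AE sq_meas) simp
  have finite_sq: "integrable (\<kappa> n x) (\<lambda>y. (h y)\<^sup>2)" if "(\<integral>\<^sup>+y. ennreal ((h y)\<^sup>2) \<partial>\<kappa> n x) \<noteq> \<infinity>" for x
  proof (rule integrableI_bounded)
    show "(\<lambda>y. (h y)\<^sup>2) \<in> borel_measurable (\<kappa> n x)"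
      unfolding kernel_measurable_iff[OF n] by measurable
    show "(\<integral>\<^sup>+y. ennreal (norm ((h y)\<^sup>2)) \<partial>\<kappa> n x) < \<infinity>"
      using that by (simp add: top.not_eq_extremum)
  qed
  have AE_sq: "AE \<omega> in \<mu>. integrable (\<kappa> n (\<omega> n)) (\<lambda>y. (h y)\<^sup>2)"
    using AE_fin by (rule eventually_mono) (rule finite_sq)
  have int: "integrable (\<kappa> n x) h" if "integrable (\<kappa> n x) (\<lambda>y. (h y)\<^sup>2)" for x
  proof -
    interpret P: prob_space "\<kappa> n x"
      using n by (rule prob_space_kernel)
    have "h \<in> borel_measurable (\<kappa> n x)"
      unfolding kernel_measurable_iff[OF n] by (rule h)
    then show ?thesis
      using that by (rule P.square_integrable_imp_integrable)
  qed
  show "AE \<omega> in \<mu>. ennreal (condE \<kappa> n h (\<omega> n)) = (\<integral>\<^sup>+y. ennreal (h y) \<partial>\<kappa> n (\<omega> n))"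
    using AE_sq unfolding condE_def
    by (rule eventually_mono) (intro nn_integral_eq_integral[symmetric] int AE_I2 h0)
  have jensen: "(condE \<kappa> n h x)\<^sup>2 \<le> (\<integral>y. (h y)\<^sup>2 \<partial>\<kappa> n x)" if "integrable (\<kappa> n x) (\<lambda>y. (h y)\<^sup>2)" for x
  proof -
    interpret P: prob_space "\<kappa> n x"
      using n by (rule prob_space_kernel)
    show ?thesis
      using P.variance_positive[of h] unfolding P.variance_eq[OF int[OF that] that] condE_def by simp
  qed
  have "(\<integral>\<^sup>+\<omega>. ennreal ((condE \<kappa> n h (\<omega> n))\<^sup>2) \<partial>\<mu>) \<le> (\<integral>\<^sup>+\<omega>. (\<integral>\<^sup>+y. ennreal ((h y)\<^sup>2) \<partial>\<kappa> n (\<omega> n)) \<partial>\<mu>)"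
  proof (rule nn_integral_mono_AE, rule eventually_mono[OF AE_sq])
    fix \<omega> assume "integrable (\<kappa> n (\<omega> n)) (\<lambda>y. (h y)\<^sup>2)"
    then show "ennreal ((condE \<kappa> n h (\<omega> n))\<^sup>2) \<le> (\<integral>\<^sup>+y. ennreal ((h y)\<^sup>2) \<partial>\<kappa> n (\<omega> n))"
      by (subst nn_integral_eq_integral) (auto intro: jensen ennreal_leI)
  qed
  then have "(\<integral>\<^sup>+\<omega>. ennreal (norm ((condE \<kappa> n h (\<omega> n))\<^sup>2)) \<partial>\<mu>) < \<infinity>"
    using fin by simp
  moreover have "(\<lambda>\<omega>. (condE \<kappa> n h (\<omega> n))\<^sup>2) \<in> borel_measurable \<mu>"
    using n by measurable
  ultimately show "integrable \<mu> (\<lambda>\<omega>. (condE \<kappa> n h (\<omega> n))\<^sup>2)"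
    by (intro integrableI_bounded)
qed

end

section \<open>Idealized algorithm\<close>

lemma rbf_measurable [measurable]:
  assumes "\<sigma> \<in> borel_measurable borel"
  shows "rbf \<sigma> a b k \<in> borel_measurable borel"
  unfolding rbf_def[abs_def] using assms by measurable

lemma rbf_bounded:
  assumes "bounded (range \<sigma>)"
  obtains B where "B \<ge> 0" "\<And>k x. \<bar>rbf \<sigma> a b k x\<bar> \<le> B"
proof -
  from assms obtain B where "\<And>y. \<bar>\<sigma> y\<bar> \<le> B"
    unfolding bounded_iff by auto
  then show thesis
    by (intro that[of "\<bar>B\<bar>"]) (auto simp: rbf_def intro: order_trans[OF _ abs_ge_self])
qed

text \<open>Boundedness of \<open>\<sigma>\<close> makes the basis square integrable for any finite
  measure, so a minimizer exists and the choice in \<open>L2proj\<close> returns one. All that is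
  retained of it is membership in the span and its normal equations.\<close>

lemma L2proj_normal:
  assumes \<pi>: "finite_measure \<pi>" "sets \<pi> = sets borel"
    and \<sigma>: "\<sigma> \<in> borel_measurable borel" "bounded (range \<sigma>)"
    and J: "J \<in> borel_measurable borel" "integrable \<pi> (\<lambda>x. (J x)\<^sup>2)"
  shows "\<exists>\<theta>. L2proj \<pi> \<sigma> a b K J = PhiK \<sigma> a b K \<theta> \<and>
    (\<forall>\<eta>. (\<integral>x. (J x - PhiK \<sigma> a b K \<theta> x) * PhiK \<sigma> a b K \<eta> x \<partial>\<pi>) = 0)"
proof -
  interpret finite_measure \<pi>
    by (rule \<pi>(1))
  have meas: "f \<in> borel_measurable \<pi> \<longleftrightarrow> f \<in> borel_measurable borel" for f :: "real^'a \<Rightarrow> real"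
    by (rule arg_cong[where f = "\<lambda>A. f \<in> A"], rule measurable_cong_sets) (simp_all add: \<pi>)
  obtain B where B: "B \<ge> 0" "\<And>k x. \<bar>rbf \<sigma> a b k x\<bar> \<le> B"
    using rbf_bounded[OF \<sigma>(2), of a b] by blast
  have F: "rbf \<sigma> a b k \<in> borel_measurable \<pi>" for k
    unfolding meas using \<sigma>(1) by (rule rbf_measurable)
  have Fsq: "integrable \<pi> (\<lambda>x. (rbf \<sigma> a b k x)\<^sup>2)" for k
  proof (rule integrable_const_bound[where B = "B\<^sup>2"])
    show "AE x in \<pi>. norm ((rbf \<sigma> a b k x)\<^sup>2) \<le> B\<^sup>2"
      using order_trans[OF B(2) abs_ge_self] by (simp add: abs_le_square_iff)
    show "(\<lambda>x. (rbf \<sigma> a b k x)\<^sup>2) \<in> borel_measurable \<pi>"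
      using F[of k] by measurable
  qed
  have J': "J \<in> borel_measurable \<pi>"
    unfolding meas by (rule J)
  let ?opt = "\<lambda>f. f \<in> span_rbf \<sigma> a b K \<and>
      (\<forall>h\<in>span_rbf \<sigma> a b K. (\<integral>x. (J x - f x)\<^sup>2 \<partial>\<pi>) \<le> (\<integral>x. (J x - h x)\<^sup>2 \<partial>\<pi>))"
  obtain \<theta>0 where "\<forall>\<theta>'. (\<integral>x. (J x - PhiK \<sigma> a b K \<theta>0 x)\<^sup>2 \<partial>\<pi>) \<le> (\<integral>x. (J x - PhiK \<sigma> a b K \<theta>' x)\<^sup>2 \<partial>\<pi>)"
    unfolding PhiK_eq_lincomb using least_squares_ex[of K "rbf \<sigma> a b" \<pi> J, OF F Fsq J' J(2)] by blast
  then have "?opt (PhiK \<sigma> a b K \<theta>0)"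
    unfolding span_rbf_def by blast
  from someI[of ?opt, OF this] have opt: "?opt (L2proj \<pi> \<sigma> a b K J)"
    unfolding L2proj_def .
  then obtain \<theta> where \<theta>: "L2proj \<pi> \<sigma> a b K J = PhiK \<sigma> a b K \<theta>"
    unfolding span_rbf_def by blast
  have "(\<integral>x. (J x - PhiK \<sigma> a b K \<theta> x) * PhiK \<sigma> a b K \<eta> x \<partial>\<pi>) = 0" for \<eta>
    unfolding PhiK_eq_lincomb
  proof (rule least_squares_normal[OF F Fsq J' J(2)])
    show "(\<integral>x. (J x - lincomb (rbf \<sigma> a b) K \<theta> x)\<^sup>2 \<partial>\<pi>) \<le> (\<integral>x. (J x - lincomb (rbf \<sigma> a b) K \<theta>' x)\<^sup>2 \<partial>\<pi>)" for \<theta>'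
      using opt unfolding \<theta> span_rbf_def PhiK_eq_lincomb by blast
  qed
  with \<theta> show ?thesis
    by blast
qed

locale lsm = markov_path_law \<mu> \<kappa> N
  for \<mu> :: "(nat \<Rightarrow> real^'d) measure" and \<kappa> :: "nat \<Rightarrow> real^'d \<Rightarrow> (real^'d) measure" and N :: nat +
  fixes g :: "real^'d \<Rightarrow> real"
    and disc :: real
    and \<sigma> :: "real \<Rightarrow> real"
    and a :: "nat \<Rightarrow> real^'d" and b :: "nat \<Rightarrow> real"
    and K :: nat
  assumes g_meas: "g \<in> borel_measurable borel"
    and g_nonneg: "\<forall>x. g x \<ge> 0"
    and g_L2: "\<forall>n\<le>N. integrable \<mu> (\<lambda>\<omega>. (g (\<omega> n))\<^sup>2)"
    and disc_pos: "disc > 0"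
    and \<sigma>_meas: "\<sigma> \<in> borel_measurable borel"
    and \<sigma>_bdd: "bounded (range \<sigma>)"
begin

abbreviation P :: "nat \<Rightarrow> real^'d \<Rightarrow> real" where
  "P n \<equiv> Pid g disc \<kappa> \<mu> \<sigma> a b K N n"

abbreviation cont :: "nat \<Rightarrow> real^'d \<Rightarrow> real" where
  "cont n \<equiv> condE \<kappa> n (P (Suc n))"

abbreviation fit :: "nat \<Rightarrow> real^'d \<Rightarrow> real" where
  "fit n \<equiv> L2proj (marg \<mu> n) \<sigma> a b K (cont n)"

text \<open>The recursion counts the remaining steps, as in \<open>Pid_aux\<close> and
  \<open>pemp_aux\<close>, so that the three schemes unfold in parallel.\<close>

primrec path_value_aux :: "nat \<Rightarrow> (nat \<Rightarrow> real^'d) \<Rightarrow> real" where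
  "path_value_aux 0 \<omega> = g (\<omega> N)"
| "path_value_aux (Suc j) \<omega> =
    (if disc * fit (N - Suc j) (\<omega> (N - Suc j)) \<le> g (\<omega> (N - Suc j)) then g (\<omega> (N - Suc j))
     else disc * path_value_aux j \<omega>)"

text \<open>The discounted payoff along a path when stopping is decided by the idealized regressions.
  It is the limiting counterpart of \<open>pemp_aux\<close>, and its conditional expectation is \<open>P n\<close>.\<close>

definition path_value :: "nat \<Rightarrow> (nat \<Rightarrow> real^'d) \<Rightarrow> real" where
  "path_value n = path_value_aux (N - n)"

lemma P_final: "P N = g"
  by (simp add: Pid_def)

lemma P_step:
  assumes "n < N"
  shows "P n = (\<lambda>x. if disc * fit n x \<le> g x then g x else disc * cont n x)"
proof -
  have "N - n = Suc (N - Suc n)" "N - Suc (N - Suc n) = n"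
    using assms by auto
  then show ?thesis
    by (simp only: Pid_def Pid_aux.simps Let_def)
qed

lemma path_value_final: "path_value N = (\<lambda>\<omega>. g (\<omega> N))"
  by (simp add: path_value_def fun_eq_iff)

lemma path_value_step:
  assumes "n < N"
  shows "path_value n \<omega> =
    (if disc * fit n (\<omega> n) \<le> g (\<omega> n) then g (\<omega> n) else disc * path_value (Suc n) \<omega>)"
proof -
  have "N - n = Suc (N - Suc n)" "N - Suc (N - Suc n) = n"
    using assms by auto
  then show ?thesis
    by (simp only: path_value_def path_value_aux.simps)
qed

section \<open>Marginal laws and regularity of the idealized values\<close>

lemma finite_measure_marg: "n \<le> N \<Longrightarrow> finite_measure (marg \<mu> n)"
  unfolding marg_def by (intro finite_measure_distr) auto

lemma integral_marg:
  fixes f :: "real^'d \<Rightarrow> real"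
  assumes "n \<le> N" "f \<in> borel_measurable borel"
  shows "(\<integral>x. f x \<partial>marg \<mu> n) = (\<integral>\<omega>. f (\<omega> n) \<partial>\<mu>)"
    and "integrable (marg \<mu> n) f \<longleftrightarrow> integrable \<mu> (\<lambda>\<omega>. f (\<omega> n))"
  unfolding marg_def using assms by (auto intro!: integral_distr integrable_distr_eq)

text \<open>The regularity of \<open>P (Suc n)\<close> is a hypothesis here because this fact is
  used inside the induction that establishes regularity.\<close>

lemma fit_normal_aux:
  assumes n: "n < N" and P: "P (Suc n) \<in> borel_measurable borel" "\<And>x. P (Suc n) x \<ge> 0"
    "integrable \<mu> (\<lambda>\<omega>. (P (Suc n) (\<omega> (Suc n)))\<^sup>2)"
  shows "\<exists>\<theta>. fit n = PhiK \<sigma> a b K \<theta> \<and>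
    (\<forall>\<eta>. (\<integral>\<omega>. (cont n (\<omega> n) - PhiK \<sigma> a b K \<theta> (\<omega> n)) * PhiK \<sigma> a b K \<eta> (\<omega> n) \<partial>\<mu>) = 0)"
proof -
  have [measurable]: "cont n \<in> borel_measurable borel"
    using condE_measurable[OF n P(1)] .
  have "PhiK \<sigma> a b K \<theta> \<in> borel_measurable borel" for \<theta>
    unfolding PhiK_eq_lincomb using \<sigma>_meas by (intro lincomb_borel_measurable rbf_measurable)
  then have [measurable]: "(\<lambda>x. (cont n x - PhiK \<sigma> a b K \<theta> x) * PhiK \<sigma> a b K \<eta> x) \<in> borel_measurable borel" for \<theta> \<eta>
    by measurable
  have "\<exists>\<theta>. fit n = PhiK \<sigma> a b K \<theta> \<and>
    (\<forall>\<eta>. (\<integral>x. (cont n x - PhiK \<sigma> a b K \<theta> x) * PhiK \<sigma> a b K \<eta> x \<partial>marg \<mu> n) = 0)"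
  proof (rule L2proj_normal)
    show "finite_measure (marg \<mu> n)"
      using n by (intro finite_measure_marg) simp
    show "integrable (marg \<mu> n) (\<lambda>x. (cont n x)\<^sup>2)"
      using condE_square_integrable[OF n P] n by (subst integral_marg(2)) auto
  qed (auto simp: marg_def \<sigma>_meas \<sigma>_bdd)
  then show ?thesis
    using n by (simp add: integral_marg)
qed

text \<open>The three properties have to be carried together: measurability of \<open>P n\<close>
  needs that of the fit, which is known once the fit is a combination of basis functions, and this
  rests on the nonnegativity and square integrability of the next value.\<close>

lemma P_regular:
  assumes "n \<le> N"
  shows "P n \<in> borel_measurable borel \<and> (\<forall>x. P n x \<ge> 0) \<and> integrable \<mu> (\<lambda>\<omega>. (P n (\<omega> n))\<^sup>2)"
  using assms
proof (induction rule: inc_induct)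
  case base
  then show ?case
    using g_meas g_nonneg g_L2 by (simp add: P_final)
next
  case (step n)
  then have n: "n < N" and P: "P (Suc n) \<in> borel_measurable borel" "\<And>x. P (Suc n) x \<ge> 0"
    "integrable \<mu> (\<lambda>\<omega>. (P (Suc n) (\<omega> (Suc n)))\<^sup>2)"
    by auto
  note [measurable] = condE_measurable[OF n P(1)] g_meas
  have coord [measurable]: "(\<lambda>\<omega>. \<omega> n) \<in> \<mu> \<rightarrow>\<^sub>M borel"
    using n by simp
  have cont_nonneg: "cont n x \<ge> 0" for x
    unfolding condE_def using P(2) by (intro Bochner_Integration.integral_nonneg)
  obtain \<theta> where \<theta>: "fit n = PhiK \<sigma> a b K \<theta>"
    using fit_normal_aux[OF n P] by blast
  have fit_meas [measurable]: "fit n \<in> borel_measurable borel"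
    unfolding \<theta> PhiK_eq_lincomb using \<sigma>_meas by (intro lincomb_borel_measurable rbf_measurable)
  have meas [measurable]: "P n \<in> borel_measurable borel"
    unfolding P_step[OF n] by measurable
  have "integrable \<mu> (\<lambda>\<omega>. (P n (\<omega> n))\<^sup>2)"
  proof (rule Bochner_Integration.integrable_bound)
    show "integrable \<mu> (\<lambda>\<omega>. (g (\<omega> n))\<^sup>2 + disc\<^sup>2 * (cont n (\<omega> n))\<^sup>2)"
      using condE_square_integrable[OF n P] g_L2 n by simp
    show "(\<lambda>\<omega>. (P n (\<omega> n))\<^sup>2) \<in> borel_measurable \<mu>"
      by measurable
    show "AE \<omega> in \<mu>. norm ((P n (\<omega> n))\<^sup>2) \<le> norm ((g (\<omega> n))\<^sup>2 + disc\<^sup>2 * (cont n (\<omega> n))\<^sup>2)"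
      unfolding P_step[OF n] by (intro AE_I2) (simp add: power_mult_distrib)
  qed
  moreover have "P n x \<ge> 0" for x
    unfolding P_step[OF n] using g_nonneg cont_nonneg disc_pos by simp
  ultimately show ?case
    using meas by blast
qed

lemma
  assumes "n \<le> N"
  shows P_measurable [measurable]: "P n \<in> borel_measurable borel"
    and P_nonneg: "P n x \<ge> 0"
    and P_square_integrable: "integrable \<mu> (\<lambda>\<omega>. (P n (\<omega> n))\<^sup>2)"
  using P_regular[OF assms] by auto

lemma
  assumes n: "n < N"
  shows cont_measurable [measurable]: "cont n \<in> borel_measurable borel"
    and cont_nonneg: "cont n x \<ge> 0"
    and cont_square_integrable: "integrable \<mu> (\<lambda>\<omega>. (cont n (\<omega> n))\<^sup>2)"
    and cont_nn: "AE \<omega> in \<mu>. ennreal (cont n (\<omega> n)) = (\<integral>\<^sup>+y. ennreal (P (Suc n) y) \<partial>\<kappa> n (\<omega> n))"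
    and fit_normal: "\<exists>\<theta>. fit n = PhiK \<sigma> a b K \<theta> \<and>
      (\<forall>\<eta>. (\<integral>\<omega>. (cont n (\<omega> n) - PhiK \<sigma> a b K \<theta> (\<omega> n)) * PhiK \<sigma> a b K \<eta> (\<omega> n) \<partial>\<mu>) = 0)"
proof -
  have P: "P (Suc n) \<in> borel_measurable borel" "\<And>x. P (Suc n) x \<ge> 0"
    "integrable \<mu> (\<lambda>\<omega>. (P (Suc n) (\<omega> (Suc n)))\<^sup>2)"
    using n P_measurable P_nonneg P_square_integrable by auto
  show "cont n \<in> borel_measurable borel"
    by (rule condE_measurable[OF n P(1)])
  show "cont n x \<ge> 0"
    unfolding condE_def using P(2) by (intro Bochner_Integration.integral_nonneg)
  show "integrable \<mu> (\<lambda>\<omega>. (cont n (\<omega> n))\<^sup>2)"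
    by (rule condE_square_integrable[OF n P])
  show "AE \<omega> in \<mu>. ennreal (cont n (\<omega> n)) = (\<integral>\<^sup>+y. ennreal (P (Suc n) y) \<partial>\<kappa> n (\<omega> n))"
    by (rule condE_nn[OF n P])
  show "\<exists>\<theta>. fit n = PhiK \<sigma> a b K \<theta> \<and>
      (\<forall>\<eta>. (\<integral>\<omega>. (cont n (\<omega> n) - PhiK \<sigma> a b K \<theta> (\<omega> n)) * PhiK \<sigma> a b K \<eta> (\<omega> n) \<partial>\<mu>) = 0)"
    by (rule fit_normal_aux[OF n P])
qed

lemma PhiK_measurable [measurable]: "PhiK \<sigma> a b K \<theta> \<in> borel_measurable borel"
  unfolding PhiK_eq_lincomb using \<sigma>_meas by (intro lincomb_borel_measurable rbf_measurable)

lemma PhiK_bounded: "\<exists>B\<ge>0. \<forall>x. \<bar>PhiK \<sigma> a b K \<theta> x\<bar> \<le> B"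
proof -
  obtain B where "B \<ge> 0" "\<And>k x. \<bar>rbf \<sigma> a b k x\<bar> \<le> B"
    using rbf_bounded[OF \<sigma>_bdd, of a b] by blast
  then have "\<bar>PhiK \<sigma> a b K \<theta> x\<bar> \<le> (\<Sum>k<K. \<bar>\<theta> k\<bar>) * B" for x
    unfolding PhiK_eq_lincomb by (intro lincomb_bounded)
  with \<open>B \<ge> 0\<close> show ?thesis
    by (intro exI[of _ "(\<Sum>k<K. \<bar>\<theta> k\<bar>) * B"]) (auto intro: mult_nonneg_nonneg sum_nonneg)
qed

lemma fit_measurable [measurable]: "n < N \<Longrightarrow> fit n \<in> borel_measurable borel"
  using fit_normal[of n] PhiK_measurable by auto

lemma path_value_regular:
  assumes "n \<le> N"
  shows "path_value n \<in> borel_measurable \<mu> \<and> (\<forall>\<omega>. path_value n \<omega> \<ge> 0) \<and>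
    integrable \<mu> (\<lambda>\<omega>. (path_value n \<omega>)\<^sup>2)"
  using assms
proof (induction rule: inc_induct)
  case base
  have "(\<lambda>\<omega>. g (\<omega> N)) \<in> borel_measurable \<mu>"
    using g_meas by measurable
  then show ?case
    using g_nonneg g_L2 by (simp add: path_value_final)
next
  case (step n)
  then have n: "n < N" by simp
  have coord [measurable]: "(\<lambda>\<omega>. \<omega> n) \<in> \<mu> \<rightarrow>\<^sub>M borel"
    using n by simp
  note [measurable] = fit_measurable[OF n] g_meas
  have V [measurable]: "path_value (Suc n) \<in> borel_measurable \<mu>"
    using step by simp
  have "(\<lambda>\<omega>. if disc * fit n (\<omega> n) \<le> g (\<omega> n) then g (\<omega> n) else disc * path_value (Suc n) \<omega>) \<in> borel_measurable \<mu>"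
    by measurable
  then have meas [measurable]: "path_value n \<in> borel_measurable \<mu>"
    by (subst measurable_cong[OF path_value_step[OF n]])
  have "integrable \<mu> (\<lambda>\<omega>. (path_value n \<omega>)\<^sup>2)"
  proof (rule Bochner_Integration.integrable_bound)
    show "integrable \<mu> (\<lambda>\<omega>. (g (\<omega> n))\<^sup>2 + disc\<^sup>2 * (path_value (Suc n) \<omega>)\<^sup>2)"
      using step g_L2 n by simp
    show "(\<lambda>\<omega>. (path_value n \<omega>)\<^sup>2) \<in> borel_measurable \<mu>"
      by measurable
    show "AE \<omega> in \<mu>. norm ((path_value n \<omega>)\<^sup>2) \<le> norm ((g (\<omega> n))\<^sup>2 + disc\<^sup>2 * (path_value (Suc n) \<omega>)\<^sup>2)"
      unfolding path_value_step[OF n] by (intro AE_I2) (simp add: power_mult_distrib)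
  qed
  moreover have "path_value n \<omega> \<ge> 0" for \<omega>
    unfolding path_value_step[OF n] using g_nonneg step disc_pos by simp
  ultimately show ?case
    using meas by blast
qed

lemma
  assumes "n \<le> N"
  shows path_value_measurable [measurable]: "path_value n \<in> borel_measurable \<mu>"
    and path_value_nonneg: "path_value n \<omega> \<ge> 0"
    and path_value_square_integrable: "integrable \<mu> (\<lambda>\<omega>. (path_value n \<omega>)\<^sup>2)"
  using path_value_regular[OF assms] by auto

section \<open>Conditional expectations of path values and the common normal equations\<close>

lemma P_tower:
  assumes n: "n < N" and \<psi>: "\<psi> \<in> borel_measurable (Pi\<^sub>M {..n} (\<lambda>_. (borel :: (real^'d) measure)))"
  shows "(\<integral>\<^sup>+\<omega>. \<psi> (restrict \<omega> {..n}) * ennreal (P (Suc n) (\<omega> (Suc n))) \<partial>\<mu>)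
    = (\<integral>\<^sup>+\<omega>. \<psi> (restrict \<omega> {..n}) * ennreal (cont n (\<omega> n)) \<partial>\<mu>)"
proof -
  have "(\<lambda>y. ennreal (P (Suc n) y)) \<in> borel_measurable borel"
    using n by (intro measurable_compose[OF P_measurable measurable_ennreal]) simp
  from markov_nn_integral[OF n \<psi> this]
  have "(\<integral>\<^sup>+\<omega>. \<psi> (restrict \<omega> {..n}) * ennreal (P (Suc n) (\<omega> (Suc n))) \<partial>\<mu>)
    = (\<integral>\<^sup>+\<omega>. \<psi> (restrict \<omega> {..n}) * (\<integral>\<^sup>+y. ennreal (P (Suc n) y) \<partial>\<kappa> n (\<omega> n)) \<partial>\<mu>)" .
  also have "\<dots> = (\<integral>\<^sup>+\<omega>. \<psi> (restrict \<omega> {..n}) * ennreal (cont n (\<omega> n)) \<partial>\<mu>)"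
    by (rule nn_integral_cong_AE, rule eventually_mono[OF cont_nn[OF n]]) (simp only:)
  finally show ?thesis .
qed

text \<open>This is the identity between \<open>P n\<close> and the conditional expectation of
  \<open>path_value n\<close> given the past, in weak form: equality against all nonnegative
  functions of the past. The test function varies in the induction because each step multiplies it
  by an indicator.\<close>

lemma path_value_tower:
  assumes "n \<le> N" and "\<psi> \<in> borel_measurable (Pi\<^sub>M {..n} (\<lambda>_. (borel :: (real^'d) measure)))"
  shows "(\<integral>\<^sup>+\<omega>. \<psi> (restrict \<omega> {..n}) * ennreal (path_value n \<omega>) \<partial>\<mu>)
    = (\<integral>\<^sup>+\<omega>. \<psi> (restrict \<omega> {..n}) * ennreal (P n (\<omega> n)) \<partial>\<mu>)"
  using assms
proof (induction arbitrary: \<psi> rule: inc_induct)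
  case base
  show ?case
    by (simp only: path_value_final P_final)
next
  case (step n)
  then have n: "n < N" by simp
  define D where "D x \<longleftrightarrow> disc * fit n x \<le> g x" for x
  note [measurable] = fit_measurable[OF n] g_meas step.prems
  have [measurable]: "Measurable.pred borel D"
    unfolding D_def by measurable
  have [measurable]: "(\<lambda>\<omega>. \<omega> n) \<in> \<mu> \<rightarrow>\<^sub>M borel"
      "(\<lambda>\<omega>. restrict \<omega> {..n}) \<in> \<mu> \<rightarrow>\<^sub>M Pi\<^sub>M {..n} (\<lambda>_. (borel :: (real^'d) measure))"
      "cont n \<in> borel_measurable borel" "path_value (Suc n) \<in> borel_measurable \<mu>"
    using n by (auto intro: cont_measurable)
  have past_past: "restrict (restrict \<omega> {..Suc n}) {..n} = restrict \<omega> {..n}" for \<omega> :: "nat \<Rightarrow> real^'d"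
    by (auto simp: fun_eq_iff)
  \<comment> \<open>Whether to continue at time \<open>n\<close> is known from the past, so its
    indicator can be absorbed into the test function. To meet the induction hypothesis, the result
    is then read as a function of the past up to \<open>Suc n\<close>.\<close>
  define \<psi>1 where "\<psi>1 r = \<psi> r * of_bool (\<not> D (r n))" for r
  have [measurable]: "(\<lambda>r. r n) \<in> Pi\<^sub>M {..n} (\<lambda>_. borel) \<rightarrow>\<^sub>M (borel :: (real^'d) measure)"
    by (rule measurable_component_singleton) simp
  have \<psi>1: "\<psi>1 \<in> borel_measurable (Pi\<^sub>M {..n} (\<lambda>_. (borel :: (real^'d) measure)))"
    unfolding \<psi>1_def by measurable
  have \<psi>2: "(\<lambda>r. \<psi>1 (restrict r {..n})) \<in> borel_measurable (Pi\<^sub>M {..Suc n} (\<lambda>_. (borel :: (real^'d) measure)))"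
    by (rule measurable_compose[OF measurable_restrict_subset \<psi>1]) auto
  define A where "A \<omega> = \<psi> (restrict \<omega> {..n}) * (of_bool (D (\<omega> n)) * ennreal (g (\<omega> n)))" for \<omega>
  define Q where "Q \<omega> = \<psi>1 (restrict \<omega> {..n})" for \<omega>
  have Q_eq: "Q \<omega> = \<psi> (restrict \<omega> {..n}) * of_bool (\<not> D (\<omega> n))" for \<omega>
    unfolding Q_def \<psi>1_def by simp
  have [measurable]: "A \<in> borel_measurable \<mu>" "Q \<in> borel_measurable \<mu>"
    unfolding A_def Q_def using \<psi>1 by measurable
  have "(\<integral>\<^sup>+\<omega>. \<psi> (restrict \<omega> {..n}) * ennreal (path_value n \<omega>) \<partial>\<mu>)
      = (\<integral>\<^sup>+\<omega>. A \<omega> + ennreal disc * (Q \<omega> * ennreal (path_value (Suc n) \<omega>)) \<partial>\<mu>)"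
    unfolding path_value_step[OF n] A_def Q_eq D_def using disc_pos n
    by (intro nn_integral_cong) (simp add: ennreal_mult path_value_nonneg mult.left_commute)
  also have "\<dots> = (\<integral>\<^sup>+\<omega>. A \<omega> \<partial>\<mu>) + ennreal disc * (\<integral>\<^sup>+\<omega>. Q \<omega> * ennreal (path_value (Suc n) \<omega>) \<partial>\<mu>)"
    by (subst nn_integral_add) (auto simp: nn_integral_cmult)
  also have "(\<integral>\<^sup>+\<omega>. Q \<omega> * ennreal (path_value (Suc n) \<omega>) \<partial>\<mu>) = (\<integral>\<^sup>+\<omega>. Q \<omega> * ennreal (cont n (\<omega> n)) \<partial>\<mu>)"
    using step.IH[OF \<psi>2] P_tower[OF n \<psi>1] unfolding past_past Q_def by (simp only:)
  also have "(\<integral>\<^sup>+\<omega>. A \<omega> \<partial>\<mu>) + ennreal disc * (\<integral>\<^sup>+\<omega>. Q \<omega> * ennreal (cont n (\<omega> n)) \<partial>\<mu>)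
      = (\<integral>\<^sup>+\<omega>. A \<omega> + ennreal disc * (Q \<omega> * ennreal (cont n (\<omega> n))) \<partial>\<mu>)"
    by (subst nn_integral_add) (auto simp: nn_integral_cmult)
  also have "\<dots> = (\<integral>\<^sup>+\<omega>. \<psi> (restrict \<omega> {..n}) * ennreal (P n (\<omega> n)) \<partial>\<mu>)"
    unfolding P_step[OF n] A_def Q_eq D_def using disc_pos n
    by (intro nn_integral_cong) (simp add: ennreal_mult cont_nonneg mult.left_commute)
  finally show ?case .
qed

lemma integral_path_value_mult:
  assumes n: "n < N" and \<phi> [measurable]: "\<phi> \<in> borel_measurable borel" and bound: "\<And>x. \<bar>\<phi> x\<bar> \<le> B"
  shows "(\<integral>\<omega>. path_value (Suc n) \<omega> * \<phi> (\<omega> n) \<partial>\<mu>) = (\<integral>\<omega>. cont n (\<omega> n) * \<phi> (\<omega> n) \<partial>\<mu>)"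
    and "integrable \<mu> (\<lambda>\<omega>. path_value (Suc n) \<omega> * \<phi> (\<omega> n))"
    and "integrable \<mu> (\<lambda>\<omega>. cont n (\<omega> n) * \<phi> (\<omega> n))"
proof -
  have [measurable]: "(\<lambda>\<omega>. \<omega> n) \<in> \<mu> \<rightarrow>\<^sub>M borel" "cont n \<in> borel_measurable borel"
    "path_value (Suc n) \<in> borel_measurable \<mu>"
    using n by (auto intro: cont_measurable)
  have sq: "integrable \<mu> (\<lambda>\<omega>. (f (\<omega> n))\<^sup>2)"
    if [measurable]: "f \<in> borel_measurable borel" and "\<And>x. \<bar>f x\<bar> \<le> C" for f :: "real^'d \<Rightarrow> real" and C
  proof (rule integrable_const_bound[where B = "C\<^sup>2"])
    show "AE \<omega> in \<mu>. norm ((f (\<omega> n))\<^sup>2) \<le> C\<^sup>2"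
      using order_trans[OF that(2) abs_ge_self] by (simp add: abs_le_square_iff)
  qed measurable
  have int1: "integrable \<mu> (\<lambda>\<omega>. path_value (Suc n) \<omega> * f (\<omega> n))"
    if [measurable]: "f \<in> borel_measurable borel" and "\<And>x. \<bar>f x\<bar> \<le> C" for f :: "real^'d \<Rightarrow> real" and C
    using path_value_square_integrable[of "Suc n"] n sq[OF that] by (intro integrable_mult_of_square_integrable) auto
  have int2: "integrable \<mu> (\<lambda>\<omega>. cont n (\<omega> n) * f (\<omega> n))"
    if [measurable]: "f \<in> borel_measurable borel" and "\<And>x. \<bar>f x\<bar> \<le> C" for f :: "real^'d \<Rightarrow> real" and C
    using cont_square_integrable[OF n] sq[OF that] by (intro integrable_mult_of_square_integrable) auto
  have nonneg_case: "(\<integral>\<omega>. path_value (Suc n) \<omega> * f (\<omega> n) \<partial>\<mu>) = (\<integral>\<omega>. cont n (\<omega> n) * f (\<omega> n) \<partial>\<mu>)"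
    if f [measurable]: "f \<in> borel_measurable borel" and f0: "\<And>x. f x \<ge> 0" for f :: "real^'d \<Rightarrow> real"
  proof -
    have [measurable]: "(\<lambda>r. r n) \<in> Pi\<^sub>M {..n} (\<lambda>_. borel) \<rightarrow>\<^sub>M (borel :: (real^'d) measure)"
        "(\<lambda>r. r n) \<in> Pi\<^sub>M {..Suc n} (\<lambda>_. borel) \<rightarrow>\<^sub>M (borel :: (real^'d) measure)"
      by (rule measurable_component_singleton, simp)+
    have "(\<lambda>r. ennreal (f (r n))) \<in> borel_measurable (Pi\<^sub>M {..Suc n} (\<lambda>_. (borel :: (real^'d) measure)))"
        "(\<lambda>r. ennreal (f (r n))) \<in> borel_measurable (Pi\<^sub>M {..n} (\<lambda>_. (borel :: (real^'d) measure)))"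
      by measurable
    from path_value_tower[OF _ this(1)] P_tower[OF n this(2)]
    have "(\<integral>\<^sup>+\<omega>. ennreal (f (\<omega> n)) * ennreal (path_value (Suc n) \<omega>) \<partial>\<mu>) = (\<integral>\<^sup>+\<omega>. ennreal (f (\<omega> n)) * ennreal (cont n (\<omega> n)) \<partial>\<mu>)"
      using n by simp
    then have "(\<integral>\<^sup>+\<omega>. ennreal (path_value (Suc n) \<omega> * f (\<omega> n)) \<partial>\<mu>) = (\<integral>\<^sup>+\<omega>. ennreal (cont n (\<omega> n) * f (\<omega> n)) \<partial>\<mu>)"
      using n f0 by (simp add: ennreal_mult path_value_nonneg cont_nonneg mult.commute)
    then show ?thesis
      using n f0 by (subst (1 2) integral_eq_nn_integral) (auto simp: path_value_nonneg cont_nonneg)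
  qed
  show "integrable \<mu> (\<lambda>\<omega>. path_value (Suc n) \<omega> * \<phi> (\<omega> n))" "integrable \<mu> (\<lambda>\<omega>. cont n (\<omega> n) * \<phi> (\<omega> n))"
    using int1[OF \<phi> bound] int2[OF \<phi> bound] by auto
  moreover have "integrable \<mu> (\<lambda>\<omega>. path_value (Suc n) \<omega> * B)" "integrable \<mu> (\<lambda>\<omega>. cont n (\<omega> n) * B)"
    using int1[of "\<lambda>_. B" "\<bar>B\<bar>"] int2[of "\<lambda>_. B" "\<bar>B\<bar>"] by auto
  \<comment> \<open>The tower property speaks of nonnegative test functions only; shifting
    \<open>\<phi>\<close> by its bound makes it nonnegative, and the identity for the constant
    \<open>B\<close> is subtracted at the end.\<close>
  moreover have "(\<integral>\<omega>. path_value (Suc n) \<omega> * (\<phi> (\<omega> n) + B) \<partial>\<mu>) = (\<integral>\<omega>. cont n (\<omega> n) * (\<phi> (\<omega> n) + B) \<partial>\<mu>)"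
  proof (rule nonneg_case)
    show "0 \<le> \<phi> x + B" for x
      using bound[of x] by linarith
  qed measurable
  moreover have "B \<ge> 0"
    using bound[of 0] by linarith
  moreover from this have "(\<integral>\<omega>. path_value (Suc n) \<omega> * B \<partial>\<mu>) = (\<integral>\<omega>. cont n (\<omega> n) * B \<partial>\<mu>)"
    using nonneg_case[of "\<lambda>_. B"] by simp
  ultimately show "(\<integral>\<omega>. path_value (Suc n) \<omega> * \<phi> (\<omega> n) \<partial>\<mu>) = (\<integral>\<omega>. cont n (\<omega> n) * \<phi> (\<omega> n) \<partial>\<mu>)"
    by (simp only: distrib_left Bochner_Integration.integral_add add_right_cancel)
qed

lemma residual_orthogonal:
  assumes n: "n < N"
  obtains \<theta> where "fit n = PhiK \<sigma> a b K \<theta>"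
    and "\<And>\<eta>. (\<integral>\<omega>. (path_value (Suc n) \<omega> - PhiK \<sigma> a b K \<theta> (\<omega> n)) * PhiK \<sigma> a b K \<eta> (\<omega> n) \<partial>\<mu>) = 0"
proof -
  obtain \<theta> where \<theta>: "fit n = PhiK \<sigma> a b K \<theta>"
    and orth: "\<And>\<eta>. (\<integral>\<omega>. (cont n (\<omega> n) - PhiK \<sigma> a b K \<theta> (\<omega> n)) * PhiK \<sigma> a b K \<eta> (\<omega> n) \<partial>\<mu>) = 0"
    using fit_normal[OF n] by blast
  have coord [measurable]: "(\<lambda>\<omega>. \<omega> n) \<in> \<mu> \<rightarrow>\<^sub>M borel"
    using n by simp
  have "(\<integral>\<omega>. (path_value (Suc n) \<omega> - PhiK \<sigma> a b K \<theta> (\<omega> n)) * PhiK \<sigma> a b K \<eta> (\<omega> n) \<partial>\<mu>) = 0" for \<eta>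
  proof -
    obtain B1 B2 where B: "B1 \<ge> 0" "\<And>x. \<bar>PhiK \<sigma> a b K \<theta> x\<bar> \<le> B1" "\<And>x. \<bar>PhiK \<sigma> a b K \<eta> x\<bar> \<le> B2"
      using PhiK_bounded by metis
    have int: "integrable \<mu> (\<lambda>\<omega>. PhiK \<sigma> a b K \<theta> (\<omega> n) * PhiK \<sigma> a b K \<eta> (\<omega> n))"
    proof (rule integrable_const_bound[where B = "B1 * B2"])
      show "AE \<omega> in \<mu>. norm (PhiK \<sigma> a b K \<theta> (\<omega> n) * PhiK \<sigma> a b K \<eta> (\<omega> n)) \<le> B1 * B2"
        using B by (intro AE_I2) (auto simp: abs_mult intro!: mult_mono)
    qed measurable
    note eq = integral_path_value_mult[OF n PhiK_measurable B(3)]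
    have "(\<integral>\<omega>. (path_value (Suc n) \<omega> - PhiK \<sigma> a b K \<theta> (\<omega> n)) * PhiK \<sigma> a b K \<eta> (\<omega> n) \<partial>\<mu>)
        = (\<integral>\<omega>. (cont n (\<omega> n) - PhiK \<sigma> a b K \<theta> (\<omega> n)) * PhiK \<sigma> a b K \<eta> (\<omega> n) \<partial>\<mu>)"
      unfolding left_diff_distrib using int eq by simp
    then show ?thesis
      using orth by simp
  qed
  with \<theta> show thesis
    by (rule that)
qed

end

section \<open>Convergence of the implementable algorithm\<close>

locale lsm_sample = lsm \<mu> \<kappa> N g disc \<sigma> a b K
  for \<mu> :: "(nat \<Rightarrow> real^'d) measure" and \<kappa> :: "nat \<Rightarrow> real^'d \<Rightarrow> (real^'d) measure" and N :: nat
    and g :: "real^'d \<Rightarrow> real" and disc :: real and \<sigma> :: "real \<Rightarrow> real"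
    and a :: "nat \<Rightarrow> real^'d" and b :: "nat \<Rightarrow> real" and K :: nat +
  fixes S :: "'s measure" and Y :: "nat \<Rightarrow> 's \<Rightarrow> (nat \<Rightarrow> real^'d)"
  assumes no_tie: "\<forall>n<N. measure \<mu> {\<omega>\<in>space \<mu>. disc * fit n (\<omega> n) = g (\<omega> n)} = 0"
    and S_prob: "prob_space S"
    and Y_indep: "prob_space.indep_vars S (\<lambda>_. Pi\<^sub>M {..N} (\<lambda>_. (borel :: (real^'d) measure))) Y UNIV"
    and Y_law: "\<forall>i. distr S (Pi\<^sub>M {..N} (\<lambda>_. (borel :: (real^'d) measure))) (Y i) = \<mu>"
begin

sublocale S: prob_space S
  by (rule S_prob)

section \<open>Limits along the sampled paths\<close>

lemma sample_average:
  fixes f :: "(nat \<Rightarrow> real^'d) \<Rightarrow> real"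
  assumes "f \<in> borel_measurable \<mu>" "integrable \<mu> (\<lambda>\<omega>. (f \<omega>)\<^sup>2)"
  shows "AE s in S. (\<lambda>m. (\<Sum>i<m. f (Y i s)) / real m) \<longlonglongrightarrow> (\<integral>\<omega>. f \<omega> \<partial>\<mu>)"
  using S.slln_sample[OF Y_indep, of \<mu> f] Y_law assms measurable_cong_sets[OF sets_\<mu> refl, of borel] by auto

text \<open>A countable intersection over the samples. It makes the almost everywhere expansion of
  the basis functions an exact identity at every point of a typical sample.\<close>

lemma sample_AE:
  assumes "AE \<omega> in \<mu>. Q \<omega>"
  shows "AE s in S. \<forall>i. Q (Y i s)"
  unfolding AE_all_countable
proof
  fix i
  have "Y i \<in> S \<rightarrow>\<^sub>M Pi\<^sub>M {..N} (\<lambda>_. (borel :: (real^'d) measure))"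
    using Y_indep by (simp add: S.indep_vars_def)
  then show "AE s in S. Q (Y i s)"
    by (rule AE_distrD) (subst Y_law[rule_format], rule assms)
qed

lemma near_tie_tendsto_0:
  assumes n: "n < N"
  shows "(\<lambda>k. \<integral>\<omega>. (if \<bar>disc * fit n (\<omega> n) - g (\<omega> n)\<bar> \<le> 1 / real (Suc k)
      then \<bar>g (\<omega> n) - disc * path_value (Suc n) \<omega>\<bar> else 0) \<partial>\<mu>) \<longlonglongrightarrow> 0"
proof -
  have [measurable]: "(\<lambda>\<omega>. \<omega> n) \<in> \<mu> \<rightarrow>\<^sub>M borel" "path_value (Suc n) \<in> borel_measurable \<mu>"
    "fit n \<in> borel_measurable borel" "g \<in> borel_measurable borel"
    using n g_meas by (auto intro: fit_measurable)
  define W where "W \<omega> = \<bar>g (\<omega> n) - disc * path_value (Suc n) \<omega>\<bar>" for \<omega>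
  have [measurable]: "W \<in> borel_measurable \<mu>"
    unfolding W_def by measurable
  have "integrable \<mu> (\<lambda>\<omega>. (g (\<omega> n) - disc * path_value (Suc n) \<omega>)\<^sup>2)"
    using n g_L2 path_value_square_integrable[of "Suc n"]
    by (intro square_integrable_diff) (auto simp: power_mult_distrib)
  then have W_sq: "integrable \<mu> (\<lambda>\<omega>. (W \<omega>)\<^sup>2)"
    by (simp add: W_def)
  have W_int: "integrable \<mu> W"
    by (rule square_integrable_imp_integrable[OF _ W_sq]) measurable
  have "prob {\<omega>\<in>space \<mu>. disc * fit n (\<omega> n) = g (\<omega> n)} = 0"
    using no_tie n by blast
  then have no_tie_AE: "AE \<omega> in \<mu>. disc * fit n (\<omega> n) \<noteq> g (\<omega> n)"
    by (subst (asm) prob_eq_0) auto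
  have "(\<lambda>k. \<integral>\<omega>. (if \<bar>disc * fit n (\<omega> n) - g (\<omega> n)\<bar> \<le> 1 / real (Suc k) then W \<omega> else 0) \<partial>\<mu>)
      \<longlonglongrightarrow> (\<integral>\<omega>. 0 \<partial>\<mu>)"
  proof (rule integral_dominated_convergence[OF _ _ W_int])
    show "AE \<omega> in \<mu>. (\<lambda>k. if \<bar>disc * fit n (\<omega> n) - g (\<omega> n)\<bar> \<le> 1 / real (Suc k) then W \<omega> else 0) \<longlonglongrightarrow> 0"
      using no_tie_AE
    proof (rule eventually_mono)
      fix \<omega> assume "disc * fit n (\<omega> n) \<noteq> g (\<omega> n)"
      then have pos: "\<bar>disc * fit n (\<omega> n) - g (\<omega> n)\<bar> > 0"
        by simp
      have "(\<lambda>k. 1 / real (Suc k)) \<longlonglongrightarrow> 0"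
        by real_asymp
      from order_tendstoD(2)[OF this pos]
      have "\<forall>\<^sub>F k in sequentially. (if \<bar>disc * fit n (\<omega> n) - g (\<omega> n)\<bar> \<le> 1 / real (Suc k) then W \<omega> else 0) = 0"
        by (rule eventually_mono) auto
      then show "(\<lambda>k. if \<bar>disc * fit n (\<omega> n) - g (\<omega> n)\<bar> \<le> 1 / real (Suc k) then W \<omega> else 0) \<longlonglongrightarrow> 0"
        by (rule tendsto_eventually)
    qed
    show "AE \<omega> in \<mu>. norm (if \<bar>disc * fit n (\<omega> n) - g (\<omega> n)\<bar> \<le> 1 / real (Suc k) then W \<omega> else 0) \<le> W \<omega>" for k
      by (rule AE_I2) (simp add: W_def)
  qed measurable
  then show ?thesis
    unfolding W_def by simp
qed

text \<open>The quantifiers over \<open>p\<close> and \<open>\<theta>h\<close> stand inside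
  \<open>AE\<close>: the exceptional null set depends only on limits for fixed functions of single
  paths. Targets that depend on the whole sample may therefore be inserted afterwards, path by
  path.\<close>

lemma backward_step:
  assumes n: "n < N"
  shows "AE s in S. \<forall>p \<theta>h.
    (\<lambda>m. (\<Sum>i<m. \<bar>p m i - path_value (Suc n) (Y i s)\<bar>) / real m) \<longlonglongrightarrow> 0 \<longrightarrow>
    (\<forall>m>0. \<forall>\<eta>. (\<Sum>i<m. (p m i - PhiK \<sigma> a b K (\<theta>h m) (Y i s n)) * PhiK \<sigma> a b K \<eta> (Y i s n)) = 0) \<longrightarrow>
    (\<lambda>m. (\<Sum>i<m. \<bar>(if disc * PhiK \<sigma> a b K (\<theta>h m) (Y i s n) \<le> g (Y i s n) then g (Y i s n) else disc * p m i)
        - path_value n (Y i s)\<bar>) / real m) \<longlonglongrightarrow> 0"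
proof -
  obtain \<theta> where \<theta>: "fit n = PhiK \<sigma> a b K \<theta>"
    and orth: "\<And>\<eta>. (\<integral>\<omega>. (path_value (Suc n) \<omega> - PhiK \<sigma> a b K \<theta> (\<omega> n)) * PhiK \<sigma> a b K \<eta> (\<omega> n) \<partial>\<mu>) = 0"
    using residual_orthogonal[OF n] by blast
  have [measurable]: "(\<lambda>\<omega>. \<omega> n) \<in> \<mu> \<rightarrow>\<^sub>M borel" "path_value (Suc n) \<in> borel_measurable \<mu>"
    "fit n \<in> borel_measurable borel" "g \<in> borel_measurable borel"
    using n g_meas by (auto intro: fit_measurable)
  have PhiK_path: "PhiK \<sigma> a b K \<eta> (\<omega> n) = lincomb (\<lambda>k \<omega>. rbf \<sigma> a b k (\<omega> n)) K \<eta> \<omega>" for \<eta> \<omega>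
    by (simp add: PhiK_def lincomb_def)
  have PhiK_sample: "PhiK \<sigma> a b K \<eta> (Y i s n) = lincomb (\<lambda>k i. rbf \<sigma> a b k (Y i s n)) K \<eta> i" for \<eta> i s
    by (simp add: PhiK_def lincomb_def)
  obtain B0 where B0: "\<And>k x. \<bar>rbf \<sigma> a b k x\<bar> \<le> B0"
    using rbf_bounded[OF \<sigma>_bdd, of a b] by blast
  have rbf_meas [measurable]: "rbf \<sigma> a b k \<in> borel_measurable borel" for k
    using \<sigma>_meas by (rule rbf_measurable)
  have rbf_sq: "integrable \<mu> (\<lambda>\<omega>. (rbf \<sigma> a b k (\<omega> n))\<^sup>2)" for k
  proof (rule integrable_const_bound[where B = "B0\<^sup>2"])
    show "AE \<omega> in \<mu>. norm ((rbf \<sigma> a b k (\<omega> n))\<^sup>2) \<le> B0\<^sup>2"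
      using order_trans[OF B0 abs_ge_self] by (simp add: abs_le_square_iff)
  qed measurable
  \<comment> \<open>The system is given by coefficients \<open>t j\<close>, so its elements are
    defined at every point, can be evaluated on samples, and are admissible test functions in the
    empirical normal equations. Only the converse expansion is almost everywhere.\<close>
  have "\<exists>r t c. (\<forall>i<r. \<forall>j<r. (\<integral>\<omega>. PhiK \<sigma> a b K (t i) (\<omega> n) * PhiK \<sigma> a b K (t j) (\<omega> n) \<partial>\<mu>) = (if i = j then 1 else 0)) \<and>
      (AE \<omega> in \<mu>. \<forall>k<K. rbf \<sigma> a b k (\<omega> n) = lincomb (\<lambda>j \<omega>. PhiK \<sigma> a b K (t j) (\<omega> n)) r (c k) \<omega>)"
    unfolding PhiK_path by (rule gram_schmidt) (measurable, rule rbf_sq)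
  then obtain r t c where
    ortho: "\<And>i j. i < r \<Longrightarrow> j < r \<Longrightarrow> (\<integral>\<omega>. PhiK \<sigma> a b K (t i) (\<omega> n) * PhiK \<sigma> a b K (t j) (\<omega> n) \<partial>\<mu>) = (if i = j then 1 else 0)"
    and rep: "AE \<omega> in \<mu>. \<forall>k<K. rbf \<sigma> a b k (\<omega> n) = lincomb (\<lambda>j \<omega>. PhiK \<sigma> a b K (t j) (\<omega> n)) r (c k) \<omega>"
    by blast
  have "\<forall>j. \<exists>B\<ge>0. \<forall>x. \<bar>PhiK \<sigma> a b K (t j) x\<bar> \<le> B"
    using PhiK_bounded by blast
  then obtain Bj where Bj: "\<And>j. Bj j \<ge> 0" "\<And>j x. \<bar>PhiK \<sigma> a b K (t j) x\<bar> \<le> Bj j"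
    by metis
  define B where "B = (\<Sum>j<r. Bj j)"
  have "Bj j \<le> B" if "j < r" for j
    unfolding B_def using that Bj by (intro member_le_sum) auto
  then have bound: "\<bar>PhiK \<sigma> a b K (t j) x\<bar> \<le> B" if "j < r" for j x
    using Bj(2)[of j x] that by (auto intro: order_trans)
  have "B \<ge> 0"
    unfolding B_def using Bj by (intro sum_nonneg)
  have gram: "AE s in S. (\<lambda>m. (\<Sum>i<m. PhiK \<sigma> a b K (t j) (Y i s n) * PhiK \<sigma> a b K (t l) (Y i s n)) / real m)
      \<longlonglongrightarrow> (if j = l then 1 else 0)" if j: "j < r" and l: "l < r" for j l
    unfolding ortho[OF j l, symmetric]
  proof (rule sample_average)
    show "integrable \<mu> (\<lambda>\<omega>. (PhiK \<sigma> a b K (t j) (\<omega> n) * PhiK \<sigma> a b K (t l) (\<omega> n))\<^sup>2)"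
    proof (rule integrable_const_bound[where B = "(B * B)\<^sup>2"])
      show "AE \<omega> in \<mu>. norm ((PhiK \<sigma> a b K (t j) (\<omega> n) * PhiK \<sigma> a b K (t l) (\<omega> n))\<^sup>2) \<le> (B * B)\<^sup>2"
      proof (rule AE_I2)
        fix \<omega>
        have "\<bar>PhiK \<sigma> a b K (t j) (\<omega> n) * PhiK \<sigma> a b K (t l) (\<omega> n)\<bar> \<le> B * B"
          unfolding abs_mult using bound j l \<open>B \<ge> 0\<close> by (intro mult_mono) auto
        from power_mono[OF this abs_ge_zero, of 2]
        show "norm ((PhiK \<sigma> a b K (t j) (\<omega> n) * PhiK \<sigma> a b K (t l) (\<omega> n))\<^sup>2) \<le> (B * B)\<^sup>2"
          by simp
      qed
    qed measurable
  qed measurable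
  have PhiK_sq: "integrable \<mu> (\<lambda>\<omega>. (PhiK \<sigma> a b K \<eta> (\<omega> n))\<^sup>2)" for \<eta>
    unfolding PhiK_path using rbf_sq by (intro lincomb_square_integrable) measurable
  have resid: "AE s in S. (\<lambda>m. (\<Sum>i<m. (path_value (Suc n) (Y i s) - PhiK \<sigma> a b K \<theta> (Y i s n)) * PhiK \<sigma> a b K (t j) (Y i s n)) / real m)
      \<longlonglongrightarrow> 0" if j: "j < r" for j
    unfolding orth[of "t j", symmetric]
  proof (rule sample_average)
    have sq: "integrable \<mu> (\<lambda>\<omega>. (path_value (Suc n) \<omega> - PhiK \<sigma> a b K \<theta> (\<omega> n))\<^sup>2)"
      using n path_value_square_integrable[of "Suc n"] PhiK_sq by (intro square_integrable_diff) auto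
    show "integrable \<mu> (\<lambda>\<omega>. ((path_value (Suc n) \<omega> - PhiK \<sigma> a b K \<theta> (\<omega> n)) * PhiK \<sigma> a b K (t j) (\<omega> n))\<^sup>2)"
    proof (rule Bochner_Integration.integrable_bound)
      show "integrable \<mu> (\<lambda>\<omega>. (path_value (Suc n) \<omega> - PhiK \<sigma> a b K \<theta> (\<omega> n))\<^sup>2 * B\<^sup>2)"
        using sq by (rule integrable_mult_left)
      show "AE \<omega> in \<mu>. norm (((path_value (Suc n) \<omega> - PhiK \<sigma> a b K \<theta> (\<omega> n)) * PhiK \<sigma> a b K (t j) (\<omega> n))\<^sup>2)
          \<le> norm ((path_value (Suc n) \<omega> - PhiK \<sigma> a b K \<theta> (\<omega> n))\<^sup>2 * B\<^sup>2)"
      proof (rule AE_I2)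
        fix \<omega>
        show "norm (((path_value (Suc n) \<omega> - PhiK \<sigma> a b K \<theta> (\<omega> n)) * PhiK \<sigma> a b K (t j) (\<omega> n))\<^sup>2)
          \<le> norm ((path_value (Suc n) \<omega> - PhiK \<sigma> a b K \<theta> (\<omega> n))\<^sup>2 * B\<^sup>2)"
          using power_mono[OF bound[OF j, of "\<omega> n"] abs_ge_zero, of 2]
          by (simp add: power_mult_distrib mult_left_mono)
      qed
    qed measurable
  qed measurable
  define z where "z k = (\<integral>\<omega>. (if \<bar>disc * fit n (\<omega> n) - g (\<omega> n)\<bar> \<le> 1 / real (Suc k)
      then \<bar>g (\<omega> n) - disc * path_value (Suc n) \<omega>\<bar> else 0) \<partial>\<mu>)" for k
  have z: "z \<longlonglongrightarrow> 0"
    unfolding z_def using n by (rule near_tie_tendsto_0)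
  have tie: "AE s in S. (\<lambda>m. (\<Sum>i<m. if \<bar>disc * fit n (Y i s n) - g (Y i s n)\<bar> \<le> 1 / real (Suc k)
      then \<bar>g (Y i s n) - disc * path_value (Suc n) (Y i s)\<bar> else 0) / real m) \<longlonglongrightarrow> z k" for k
    unfolding z_def
  proof (rule sample_average)
    have sq: "integrable \<mu> (\<lambda>\<omega>. (g (\<omega> n) - disc * path_value (Suc n) \<omega>)\<^sup>2)"
      using n g_L2 path_value_square_integrable[of "Suc n"]
      by (intro square_integrable_diff) (auto simp: power_mult_distrib)
    show "integrable \<mu> (\<lambda>\<omega>. (if \<bar>disc * fit n (\<omega> n) - g (\<omega> n)\<bar> \<le> 1 / real (Suc k)
      then \<bar>g (\<omega> n) - disc * path_value (Suc n) \<omega>\<bar> else 0)\<^sup>2)"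
    proof (rule Bochner_Integration.integrable_bound[OF sq])
      show "AE \<omega> in \<mu>. norm ((if \<bar>disc * fit n (\<omega> n) - g (\<omega> n)\<bar> \<le> 1 / real (Suc k)
        then \<bar>g (\<omega> n) - disc * path_value (Suc n) \<omega>\<bar> else 0)\<^sup>2) \<le> norm ((g (\<omega> n) - disc * path_value (Suc n) \<omega>)\<^sup>2)"
        by (rule AE_I2) (simp del: of_nat_Suc)
    qed measurable
  qed measurable
  \<comment> \<open>Each limit comes with its own null set; only countably many occur, indexed by
    pairs of system elements, single elements and window widths.\<close>
  have gram_AE: "AE s in S. \<forall>j l. j < r \<longrightarrow> l < r \<longrightarrow> (\<lambda>m. (\<Sum>i<m. PhiK \<sigma> a b K (t j) (Y i s n) * PhiK \<sigma> a b K (t l) (Y i s n)) / real m)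
      \<longlonglongrightarrow> (if j = l then 1 else 0)"
    unfolding AE_all_countable by (intro allI AE_impI gram)
  have resid_AE: "AE s in S. \<forall>j<r. (\<lambda>m. (\<Sum>i<m. (path_value (Suc n) (Y i s) - PhiK \<sigma> a b K \<theta> (Y i s n)) * PhiK \<sigma> a b K (t j) (Y i s n)) / real m)
      \<longlonglongrightarrow> 0"
    unfolding AE_all_countable by (intro allI AE_impI resid)
  have tie_AE: "AE s in S. \<forall>k. (\<lambda>m. (\<Sum>i<m. if \<bar>disc * fit n (Y i s n) - g (Y i s n)\<bar> \<le> 1 / real (Suc k)
      then \<bar>g (Y i s n) - disc * path_value (Suc n) (Y i s)\<bar> else 0) / real m) \<longlonglongrightarrow> z k"
    unfolding AE_all_countable by (intro allI tie)
  have rep_AE: "AE s in S. \<forall>i. \<forall>k<K. rbf \<sigma> a b k (Y i s n) = lincomb (\<lambda>j \<omega>. PhiK \<sigma> a b K (t j) (\<omega> n)) r (c k) (Y i s)"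
    by (rule sample_AE[OF rep])
  show ?thesis
    using gram_AE resid_AE tie_AE rep_AE
  proof eventually_elim
    case (elim s)
    show ?case
    proof (intro allI impI)
      fix p :: "nat \<Rightarrow> nat \<Rightarrow> real" and \<theta>h
      assume close: "(\<lambda>m. (\<Sum>i<m. \<bar>p m i - path_value (Suc n) (Y i s)\<bar>) / real m) \<longlonglongrightarrow> 0"
        and normal: "\<forall>m>0. \<forall>\<eta>. (\<Sum>i<m. (p m i - PhiK \<sigma> a b K (\<theta>h m) (Y i s n)) * PhiK \<sigma> a b K \<eta> (Y i s n)) = 0"
      have "\<exists>u. u \<longlonglongrightarrow> 0 \<and> (\<forall>m i. \<bar>PhiK \<sigma> a b K (\<theta>h m) (Y i s n) - PhiK \<sigma> a b K \<theta> (Y i s n)\<bar> \<le> u m)"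
        unfolding PhiK_sample
      proof (rule regression_uniformly_close[OF _ _ _ _ close])
        show "rbf \<sigma> a b k (Y i s n) = lincomb (\<lambda>j. lincomb (\<lambda>k i. rbf \<sigma> a b k (Y i s n)) K (t j)) r (c k) i"
          if "k < K" for i k
          using elim(4) that unfolding lincomb_def PhiK_def by blast
        show "\<bar>lincomb (\<lambda>k i. rbf \<sigma> a b k (Y i s n)) K (t j) i\<bar> \<le> B" if "j < r" for i j
          unfolding PhiK_sample[symmetric] using that by (rule bound)
      qed (use elim(1,2) normal in \<open>auto simp: PhiK_sample\<close>)
      then obtain u where u: "u \<longlonglongrightarrow> 0"
        and close_fit: "\<And>m i. \<bar>PhiK \<sigma> a b K (\<theta>h m) (Y i s n) - fit n (Y i s n)\<bar> \<le> u m"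
        unfolding \<theta> by blast
      show "(\<lambda>m. (\<Sum>i<m. \<bar>(if disc * PhiK \<sigma> a b K (\<theta>h m) (Y i s n) \<le> g (Y i s n) then g (Y i s n) else disc * p m i)
        - path_value n (Y i s)\<bar>) / real m) \<longlonglongrightarrow> 0"
        unfolding path_value_step[OF n]
        by (rule stopping_update_close[OF disc_pos u close_fit close _ z]) (use elim(3) in blast)
    qed
  qed
qed

lemma empirical_values_close:
  "AE s in S. \<forall>n\<le>N. (\<lambda>m. (\<Sum>i<m. \<bar>pemp_aux g disc \<sigma> a b K N m (\<lambda>i. Y i s) (N - n) i - path_value n (Y i s)\<bar>) / real m) \<longlonglongrightarrow> 0"
proof -
  have "AE s in S. \<forall>n<N. \<forall>p \<theta>h.
    (\<lambda>m. (\<Sum>i<m. \<bar>p m i - path_value (Suc n) (Y i s)\<bar>) / real m) \<longlonglongrightarrow> 0 \<longrightarrow>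
    (\<forall>m>0. \<forall>\<eta>. (\<Sum>i<m. (p m i - PhiK \<sigma> a b K (\<theta>h m) (Y i s n)) * PhiK \<sigma> a b K \<eta> (Y i s n)) = 0) \<longrightarrow>
    (\<lambda>m. (\<Sum>i<m. \<bar>(if disc * PhiK \<sigma> a b K (\<theta>h m) (Y i s n) \<le> g (Y i s n) then g (Y i s n) else disc * p m i)
        - path_value n (Y i s)\<bar>) / real m) \<longlonglongrightarrow> 0"
    unfolding AE_all_countable by (intro allI AE_impI backward_step)
  then show ?thesis
  proof eventually_elim
    case (elim s)
    have "(\<lambda>m. (\<Sum>i<m. \<bar>pemp_aux g disc \<sigma> a b K N m (\<lambda>i. Y i s) (N - n) i - path_value n (Y i s)\<bar>) / real m) \<longlonglongrightarrow> 0"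
      if "n \<le> N" for n
      using that
    proof (induction rule: inc_induct)
      case base
      show ?case
        by (simp add: path_value_final)
    next
      case (step n)
      define p where "p m = pemp_aux g disc \<sigma> a b K N m (\<lambda>i. Y i s) (N - Suc n)" for m
      \<comment> \<open>Written exactly as the choice inside \<open>pemp_aux\<close>, so that one
        unfolding matches the two and \<open>empirical_least_squares\<close> supplies the normal
        equations.\<close>
      define \<theta>h where "\<theta>h m = (SOME \<theta>. \<forall>\<theta>'. (\<Sum>i<m. (p m i - PhiK \<sigma> a b K \<theta> (Y i s n))\<^sup>2) / real m
          \<le> (\<Sum>i<m. (p m i - PhiK \<sigma> a b K \<theta>' (Y i s n))\<^sup>2) / real m)" for m
      have idx: "N - n = Suc (N - Suc n)" "N - Suc (N - Suc n) = n"
        using step by auto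
      have update: "pemp_aux g disc \<sigma> a b K N m (\<lambda>i. Y i s) (N - n) i =
          (if disc * PhiK \<sigma> a b K (\<theta>h m) (Y i s n) \<le> g (Y i s n) then g (Y i s n) else disc * p m i)" for m i
        unfolding \<theta>h_def p_def idx(1) pemp_aux.simps Let_def idx(2) ..
      have PhiK_sample: "PhiK \<sigma> a b K \<eta> (Y i s n) = lincomb (\<lambda>k i. rbf \<sigma> a b k (Y i s n)) K \<eta> i" for \<eta> i
        by (simp add: PhiK_def lincomb_def)
      have "(\<Sum>i<m. (p m i - PhiK \<sigma> a b K (\<theta>h m) (Y i s n)) * PhiK \<sigma> a b K \<eta> (Y i s n)) = 0" if "m > 0" for m \<eta>
        unfolding PhiK_sample using \<theta>h_def[unfolded PhiK_sample] that by (rule empirical_least_squares)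
      then show ?case
        unfolding update using elim step.IH step.hyps unfolding p_def[symmetric] by blast
    qed
    then show ?case
      by blast
  qed
qed

text \<open>No regression takes place at time 0. Since the start is almost surely \<open>x0\<close>,
  the mean of \<open>path_value 1\<close> is the continuation value at \<open>x0\<close>, by the
  tower property with the constant test function 1. The sample mean of the empirical values has the
  same limit, and taking the maximum is continuous.\<close>

theorem Uemp_tendsto_Uid:
  assumes N_pos: "N \<ge> 1" and start: "AE \<omega> in \<mu>. \<omega> 0 = x0"
  shows "AE s in S. (\<lambda>m. Uemp g disc \<sigma> a b K N x0 m (\<lambda>i. Y i s)) \<longlonglongrightarrow> Uid g disc \<kappa> \<mu> \<sigma> a b K N x0"
proof -
  have N: "0 < N" "Suc 0 \<le> N"
    using N_pos by auto
  have "(\<integral>\<omega>. path_value (Suc 0) \<omega> \<partial>\<mu>) = (\<integral>\<omega>. cont 0 (\<omega> 0) \<partial>\<mu>)"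
    using integral_path_value_mult(1)[OF N(1), of "\<lambda>_. 1" 1] by simp
  also have "\<dots> = (\<integral>\<omega>. cont 0 x0 \<partial>\<mu>)"
  proof (rule integral_cong_AE)
    show "AE \<omega> in \<mu>. cont 0 (\<omega> 0) = cont 0 x0"
      using start by (rule eventually_mono) simp
    show "(\<lambda>\<omega>. cont 0 (\<omega> 0)) \<in> borel_measurable \<mu>"
      using N by (intro measurable_compose[OF coord_measurable cont_measurable]) auto
  qed simp
  also have "\<dots> = cont 0 x0"
    by (simp add: prob_space)
  finally have mean: "(\<integral>\<omega>. path_value (Suc 0) \<omega> \<partial>\<mu>) = cont 0 x0" .
  have "AE s in S. (\<lambda>m. (\<Sum>i<m. path_value (Suc 0) (Y i s)) / real m) \<longlonglongrightarrow> cont 0 x0"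
    unfolding mean[symmetric] using N path_value_square_integrable[of "Suc 0"] by (intro sample_average) auto
  then show ?thesis
    using empirical_values_close
  proof eventually_elim
    case (elim s)
    define p where "p m = pemp_aux g disc \<sigma> a b K N m (\<lambda>i. Y i s) (N - 1)" for m
    have close: "(\<lambda>m. (\<Sum>i<m. \<bar>p m i - path_value (Suc 0) (Y i s)\<bar>) / real m) \<longlonglongrightarrow> 0"
      using elim(2) N unfolding p_def by auto
    have "(\<lambda>m. (\<Sum>i<m. p m i - path_value (Suc 0) (Y i s)) / real m) \<longlonglongrightarrow> 0"
      by (rule Lim_null_comparison[OF _ close]) (simp add: divide_right_mono)
    from tendsto_add[OF this elim(1)] have "(\<lambda>m. (\<Sum>i<m. p m i) / real m) \<longlonglongrightarrow> cont 0 x0"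
      by (simp add: add_divide_distrib[symmetric] sum.distrib[symmetric])
    then have "(\<lambda>m. max (g x0) (disc * ((\<Sum>i<m. p m i) / real m))) \<longlonglongrightarrow> max (g x0) (disc * cont 0 x0)"
      by (intro tendsto_intros)
    then show ?case
      unfolding Uemp_def Uid_def p_def by (simp add: sum_distrib_left)
  qed
qed

end

theorem theorem7:
  fixes \<mu> :: "(nat \<Rightarrow> real^'d) measure"
    and \<kappa> :: "nat \<Rightarrow> real^'d \<Rightarrow> (real^'d) measure"
    and x0 :: "real^'d"
    and g :: "real^'d \<Rightarrow> real"
    and disc :: real
    and \<sigma> :: "real \<Rightarrow> real"
    and a :: "nat \<Rightarrow> real^'d" and b :: "nat \<Rightarrow> real"
    and K N :: nat
    and S :: "'s measure"
    and Y :: "nat \<Rightarrow> 's \<Rightarrow> (nat \<Rightarrow> real^'d)"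
  assumes N_pos: "N \<ge> 1"
    and law: "prob_space \<mu>" "sets \<mu> = sets (Pi\<^sub>M {..N} (\<lambda>_. (borel :: (real^'d) measure)))"
    and start: "AE \<omega> in \<mu>. \<omega> 0 = x0"
    and kernel: "\<forall>n<N. \<kappa> n \<in> borel \<rightarrow>\<^sub>M prob_algebra borel"
    and markov: "\<forall>n<N. \<forall>A\<in>sets (Pi\<^sub>M {..n} (\<lambda>_. (borel :: (real^'d) measure))). \<forall>B\<in>sets borel.
        emeasure \<mu> {\<omega>\<in>space \<mu>. restrict \<omega> {..n} \<in> A \<and> \<omega> (Suc n) \<in> B}
        = (\<integral>\<^sup>+\<omega>. indicator A (restrict \<omega> {..n}) * emeasure (\<kappa> n (\<omega> n)) B \<partial>\<mu>)"
    and g_meas: "g \<in> borel_measurable borel"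
    and g_nonneg: "\<forall>x. g x \<ge> 0"
    and g_L2: "\<forall>n\<le>N. integrable \<mu> (\<lambda>\<omega>. (g (\<omega> n))\<^sup>2)"
    and disc_pos: "disc > 0"
    and \<sigma>_meas: "\<sigma> \<in> borel_measurable borel"
    and \<sigma>_bdd: "bounded (range \<sigma>)"
    and no_tie: "\<forall>n<N. measure \<mu> {\<omega>\<in>space \<mu>.
        disc * L2proj (marg \<mu> n) \<sigma> a b K (condE \<kappa> n (Pid g disc \<kappa> \<mu> \<sigma> a b K N (Suc n))) (\<omega> n) = g (\<omega> n)} = 0"
    and S_prob: "prob_space S"
    and Y_indep: "prob_space.indep_vars S (\<lambda>_. Pi\<^sub>M {..N} (\<lambda>_. (borel :: (real^'d) measure))) Y UNIV"
    and Y_law: "\<forall>i. distr S (Pi\<^sub>M {..N} (\<lambda>_. (borel :: (real^'d) measure))) (Y i) = \<mu>"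
  shows "AE s in S. (\<lambda>m. Uemp g disc \<sigma> a b K N x0 m (\<lambda>i. Y i s))
            \<longlonglongrightarrow> Uid g disc \<kappa> \<mu> \<sigma> a b K N x0"
proof -
  interpret lsm_sample \<mu> \<kappa> N g disc \<sigma> a b K S Y
    by (intro lsm_sample.intro lsm.intro markov_path_law.intro lsm_axioms.intro lsm_sample_axioms.intro; fact)
  show ?thesis
    using N_pos start by (rule Uemp_tendsto_Uid)
qed

end
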